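(* Every $m\in\mathbb{N}$ can be written as $m=x^2+y^2+z^2+t^2$ with $x,y,z,t\in\mathbb{Z}$ such that $x+3y+5z$ is a square. Moreover, for every $m\in\mathbb{N}$ with $16\nmid m$, one can choose $x,y,z,t\in\mathbb{Z}$ with $m=x^2+y^2+z^2+t^2$ such that $x+3y+5z\in\{1,4,9,36\}$.
   Context: Here $\mathbb{N}=\{0,1,2,\ldots\}$. A square is a number of the form $n^2$ with $n\in\mathbb{N}$. *)

theory Defs imports Main
begin

end

theory Submission
  imports Defs
    "HOL-Number_Theory.Number_Theory"
    "HOL-Computational_Algebra.Squarefree"
    "HOL-Analysis.Harmonic_Numbers"
begin

text \<open>
  If \<open>m = x\<^sup>2 + y\<^sup>2 + z\<^sup>2 + t\<^sup>2\<close> and \<open>x + 3y + 5z = a\<close>, then \<open>35m - a\<^sup>2\<close> is a sum of three squares. Conversely,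
  let \<open>35m - a\<^sup>2 = b\<^sup>2 + c\<^sup>2 + d\<^sup>2\<close> with \<open>a\<close> prime to 35. Dividing the quaternion \<open>a + bi + cj + dk\<close> by a
  quaternion of norm 35 gives a vector of norm \<open>m\<close> whose scalar product with \<open>(1, 3, 5, 0)\<close> or with
  \<open>(1, 3, 3, 4)\<close> is \<open>a\<close>. In the second case we apply rational reflections with denominator 5 or 7 that
  carry \<open>(1, 3, 3, 4)\<close> to a vector of either type; whether such a reflection is integral on the
  given vector depends on its residues mod 5 and mod 7. If the first type is never reached, then the
  vector stays integral under arbitrary words in two reflections whose product has infinite order,
  hence is fixed by both, and this forces \<open>35m - a\<^sup>2 = 19s\<^sup>2\<close>. This cannot happen
  both for \<open>a = 1\<close> and \<open>a = 9\<close>, nor both for \<open>a = 4\<close> and \<open>a = 36\<close>, as 19 divides neither 80 nor 1280.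

  The three squares theorem needs, for squarefree \<open>n\<close>, a number \<open>a > 0\<close> such that \<open>-n\<close> is a square
  mod \<open>a\<close> and \<open>-a\<close> is a square mod \<open>n\<close>; this yields a unimodular ternary form representing \<open>n\<close>. The
  conditions on \<open>a\<close> prescribe the values of real characters \<open>\<psi>\<^sub>i\<close> and ask that \<open>\<psi> = \<Prod>\<psi>\<^sub>i\<close> be 1 on the primes
  dividing \<open>a\<close>. Dirichlet's theorem can be avoided: weigh \<open>q \<le> K\<^sup>2\<close> by \<open>R(q)/\<surd>q\<close> with
  \<open>R(q) = \<Sum>d|q. \<psi>(d) \<ge> 0\<close>, and expand \<open>\<Prod>(1 + \<epsilon>\<^sub>i \<psi>\<^sub>i(q))\<close>. By the hyperbola method
  all terms are bounded except those of the trivial character and of \<open>\<psi>\<close>, which agree and are at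
  least a divergent part of the harmonic series, since \<open>R(k\<^sup>2) \<ge> 1\<close>.
\<close>

section \<open>Unimodular ternary forms\<close>

lemma nearest_multiple:
  fixes a f :: int
  assumes "a > 0"
  obtains k where "\<bar>2 * (f + a * k)\<bar> \<le> a"
proof
  let ?k = "- ((2 * f + a) div (2 * a))"
  have "(2 * f + a) = 2 * a * ((2 * f + a) div (2 * a)) + (2 * f + a) mod (2 * a)"
    by simp
  moreover have "0 \<le> (2 * f + a) mod (2 * a)" "(2 * f + a) mod (2 * a) < 2 * a"
    using assms by simp_all
  ultimately have "2 * f + 2 * (a * ?k) \<ge> - a" "2 * f + 2 * (a * ?k) \<le> a"
    by (simp_all add: algebra_simps)
  then show "\<bar>2 * (f + a * ?k)\<bar> \<le> a"
    by (simp add: algebra_simps abs_le_iff)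
qed

text \<open>The form of the symmetric matrix with rows (a, f, e), (f, b, d), (e, d, c);
  \<open>ternary_det\<close> is its determinant.\<close>

definition ternary_form :: "int \<Rightarrow> int \<Rightarrow> int \<Rightarrow> int \<Rightarrow> int \<Rightarrow> int \<Rightarrow> int \<Rightarrow> int \<Rightarrow> int \<Rightarrow> int" where
  "ternary_form a b c d e f x y z =
     a * x^2 + b * y^2 + c * z^2 + 2 * d * y * z + 2 * e * x * z + 2 * f * x * y"

definition ternary_det :: "int \<Rightarrow> int \<Rightarrow> int \<Rightarrow> int \<Rightarrow> int \<Rightarrow> int \<Rightarrow> int" where
  "ternary_det a b c d e f = a * b * c + 2 * d * e * f - a * d^2 - b * e^2 - c * f^2"

lemma sq_bound:
  fixes q h :: int
  assumes "\<bar>2 * q\<bar> \<le> h"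
  shows "4 * q^2 \<le> h^2"
proof -
  have "(2 * q)^2 \<le> h^2"
    using assms by (metis abs_ge_zero power2_abs power_mono)
  then show ?thesis by (simp add: power_mult_distrib)
qed

text \<open>Lexicographic descent on the leading coefficient \<open>a\<close> and the leading 2x2
  minor \<open>h\<close>. If \<open>3 * h^2 > 4 * a\<close>, the adjugate identity
  \<open>h * r = a + q^2\<close> with \<open>\<bar>2 * q\<bar> \<le> h\<close> yields a smaller
  minor \<open>r\<close>. Otherwise the leading binary block is reduced: either \<open>a\<close>
  drops, or \<open>3 * a^2 \<le> 4 * h\<close>, and the two inequalities force
  \<open>a = h = 1\<close>, where completing squares finishes.\<close>

theorem unimodular_ternary_form_sum_of_three_squares:
  fixes a b c d e f :: int
  assumes "a > 0" "a * b - f^2 > 0" "ternary_det a b c d e f = 1"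
  shows "\<exists>u v w. ternary_form a b c d e f x y z = u^2 + v^2 + w^2"
  using assms
proof (induction "(nat a, nat (a * b - f^2))" arbitrary: a b c d e f x y z
    rule: wf_induct_rule[OF wf_lex_prod[OF wf_less_than wf_less_than]])
  case 1
  define h where "h = a * b - f^2"
  have a: "a > 0" and h: "h > 0" and det: "ternary_det a b c d e f = 1"
    using "1.prems" by (auto simp: h_def)
  have IH: "\<exists>u v w. ternary_form a' b' c' d' e' f' x' y' z' = u^2 + v^2 + w^2"
    if "a' < a \<or> a' = a \<and> a' * b' - f'^2 < h" "a' > 0" "a' * b' - f'^2 > 0"
       "ternary_det a' b' c' d' e' f' = 1" for a' b' c' d' e' f' x' y' z'
    by (rule "1.hyps") (use that a h in \<open>auto simp: h_def\<close>)
  show ?case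
  proof (cases "3 * h^2 > 4 * a")
    case True
    obtain k where k: "\<bar>2 * ((a * d - e * f) + h * k)\<bar> \<le> h"
      using nearest_multiple h by blast
    define q where "q = (a * d - e * f) + h * k"
    define c' where "c' = c + 2 * d * k + b * k^2"
    define d' where "d' = d + b * k"
    define e' where "e' = e + f * k"
    \<comment> \<open>With e1, e2, e3 the basis, e3 + k e2 becomes the second basis vector and e2
      the third, so \<open>r\<close> takes the place of \<open>h\<close>.\<close>
    have det': "ternary_det a c' b d' f e' = 1"
      using det unfolding ternary_det_def c'_def d'_def e'_def
      by (simp add: power2_eq_square algebra_simps)
    have q: "q = a * d' - e' * f"
      unfolding q_def d'_def e'_def h_def by (simp add: power2_eq_square algebra_simps)
    define r where "r = a * c' - e'^2"
    have "h * r = a * ternary_det a c' b d' f e' + q^2"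
      unfolding r_def q h_def ternary_det_def by (simp add: power2_eq_square algebra_simps)
    then have hr: "h * r = a + q^2" using det' by simp
    have "4 * q^2 \<le> h^2"
      using sq_bound k unfolding q_def by blast
    with hr True have "4 * (h * r) < 4 * (h * h)"
      by (simp add: power2_eq_square)
    then have "r < h"
      using h by simp
    moreover have "r > 0"
    proof -
      have "h * r > 0" using hr a by (simp add: add_pos_nonneg)
      then show ?thesis using h by (simp add: zero_less_mult_iff)
    qed
    ultimately obtain u v w where
      "ternary_form a c' b d' f e' x z (y - k * z) = u^2 + v^2 + w^2"
      using IH[of a c' e' b d' f x z "y - k * z"] a det' unfolding r_def by blast
    moreover have "ternary_form a c' b d' f e' x z (y - k * z) = ternary_form a b c d e f x y z"
      unfolding ternary_form_def c'_def d'_def e'_def by (simp add: power2_eq_square algebra_simps)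
    ultimately show ?thesis by metis
  next
    case False
    obtain k where k: "\<bar>2 * (f + a * k)\<bar> \<le> a"
      using nearest_multiple a by blast
    define f' where "f' = f + a * k"
    define b' where "b' = b + 2 * f * k + a * k^2"
    define d' where "d' = d + e * k"
    have det': "ternary_det a b' c d' e f' = 1"
      using det unfolding ternary_det_def b'_def d'_def f'_def
      by (simp add: power2_eq_square algebra_simps)
    have h': "h = a * b' - f'^2"
      unfolding h_def b'_def f'_def by (simp add: power2_eq_square algebra_simps)
    have f': "4 * f'^2 \<le> a^2"
      using sq_bound k unfolding f'_def by blast
    have form': "ternary_form a b' c d' e f' (x - k * y) y z = ternary_form a b c d e f x y z"
      unfolding ternary_form_def b'_def d'_def f'_def by (simp add: power2_eq_square algebra_simps)
    show ?thesis
    proof (cases "b' < a")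
      case True
      have "a * b' > 0" using h h' zero_le_power2[of f'] by linarith
      then have "b' > 0" using a by (simp add: zero_less_mult_iff)
      moreover have "ternary_det b' a c e d' f' = 1"
        using det' unfolding ternary_det_def by (simp add: algebra_simps)
      moreover have "b' * a - f'^2 > 0" using h h' by (simp add: mult.commute)
      ultimately obtain u v w where
        "ternary_form b' a c e d' f' y (x - k * y) z = u^2 + v^2 + w^2"
        using IH[of b' a f' c e d' y "x - k * y" z] True by blast
      moreover have "ternary_form b' a c e d' f' y (x - k * y) z =
          ternary_form a b' c d' e f' (x - k * y) y z"
        unfolding ternary_form_def by (simp add: algebra_simps)
      ultimately show ?thesis using form' by metis
    next
      case b': False
      have "a * a \<le> a * b'" using a b' by simp
      then have "3 * a^2 \<le> 4 * h"
        using f' h' by (simp add: power2_eq_square)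
      have "a = 1"
      proof (rule ccontr)
        assume "a \<noteq> 1"
        then have "a \<ge> 2" using a by simp
        have "(3 * a^2)^2 \<le> (4 * h)^2"
          using \<open>3 * a^2 \<le> 4 * h\<close> by (intro power_mono) auto
        then have "27 * (a^2)^2 \<le> 16 * (3 * h^2)"
          by (simp add: power_mult_distrib)
        also have "\<dots> \<le> 64 * a" using False by simp
        finally have "a * (27 * a^3) \<le> a * 64"
          by (simp add: power2_eq_square power3_eq_cube algebra_simps)
        then have "27 * a^3 \<le> 64" using a by simp
        moreover have "2^3 \<le> a^3" using \<open>a \<ge> 2\<close> by (intro power_mono) auto
        ultimately show False by simp
      qed
      then have "f' = 0"
        using f' by (simp add: power2_eq_square) (smt (verit) mult_pos_pos mult_neg_neg)
      have "h = 1"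
      proof -
        have "\<not> h \<ge> 2"
        proof
          assume "h \<ge> 2"
          then have "2^2 \<le> h^2" by (intro power_mono) auto
          then show False using False \<open>a = 1\<close> by simp
        qed
        then show ?thesis using h by simp
      qed
      then have "b' = 1" using h' \<open>a = 1\<close> \<open>f' = 0\<close> by simp
      have "c = 1 + d'^2 + e^2"
        using det' \<open>a = 1\<close> \<open>b' = 1\<close> \<open>f' = 0\<close> unfolding ternary_det_def by simp
      then have "ternary_form a b' c d' e f' (x - k * y) y z =
          ((x - k * y) + e * z)^2 + (y + d' * z)^2 + z^2"
        unfolding ternary_form_def \<open>a = 1\<close> \<open>b' = 1\<close> \<open>f' = 0\<close> by (simp add: power2_eq_square algebra_simps)
      then show ?thesis using form' by metis
    qed
  qed
qed

text \<open>The matrix with rows (n, r, s), (r, A, B), (s, B, C) is built so that its 2x2 minors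
  through the corner n are a, b, c with a c - b^2 = n. By Sylvester's identity its determinant is 1,
  and its form takes the value n at (1, 0, 0).\<close>

lemma sum_of_three_squares_from_auxiliary:
  fixes n a b r :: int
  assumes "n > 0" "a > 0" "coprime a n" "a dvd b^2 + n" "n dvd r^2 + a"
  shows "\<exists>u v w. n = u^2 + v^2 + w^2"
proof -
  obtain c where c: "b^2 + n = a * c" using assms(4) by blast
  obtain A where A: "a + r^2 = n * A" using assms(5) by (auto simp: add.commute)
  have "coprime r n"
  proof (rule coprimeI)
    fix g assume g: "g dvd r" "g dvd n"
    then have "g dvd n * A - r^2" by (simp add: power2_eq_square)
    then have "g dvd a" using A by (metis add_diff_cancel_right')
    then show "is_unit g" using g assms(3) by (meson coprime_common_divisor)
  qed
  then obtain r' where r': "[r * r' = 1] (mod n)"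
    using cong_solve_coprime_int by blast
  define s where "s = - b * r'"
  obtain k where k: "r * r' = 1 + n * k"
    using r' by (metis cong_iff_lin cong_sym mult.commute)
  define B where "B = - b * k"
  have B: "b + r * s = n * B" using k unfolding s_def B_def by (simp add: algebra_simps)
  \<comment> \<open>Mod n one has a = -r^2, r s = -b and a c = b^2, so a (c + s^2) vanishes; a is
    then cancelled.\<close>
  have "n dvd a * (c + s^2)"
  proof -
    have a_eq: "a = n * A - r^2" using A by simp
    have "b^2 - (r * s)^2 = n * B * (2 * b - n * B)"
      unfolding B[symmetric] by (simp add: power2_eq_square algebra_simps)
    moreover have "a * s^2 = n * A * s^2 - (r * s)^2"
      unfolding a_eq by (simp add: power2_eq_square algebra_simps)
    moreover have "a * (c + s^2) = b^2 + n + a * s^2" using c by (simp add: distrib_left)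
    ultimately have "a * (c + s^2) = n + n * A * s^2 + n * B * (2 * b - n * B)"
      by linarith
    also have "\<dots> = n * (1 + A * s^2 + B * (2 * b - n * B))" by (simp add: algebra_simps)
    finally show ?thesis by simp
  qed
  then have "n dvd c + s^2"
    using assms(3) by (simp add: coprime_commute coprime_dvd_mult_right_iff)
  then obtain C where C: "c + s^2 = n * C" by blast
  have a_eq: "a = n * A - r^2" and b_eq: "b = n * B - r * s" and c_eq: "c = n * C - s^2"
    using A B C by simp_all
  have det_n: "n * ternary_det n A C B s r = n"
  proof -
    have "n^2 * ternary_det n A C B s r = n * (a * c - b^2)"
      unfolding ternary_det_def a_eq b_eq c_eq by (simp add: power2_eq_square algebra_simps)
    also have "\<dots> = n * n" using c by simp
    finally have "n * (n * ternary_det n A C B s r) = n * n" by (simp add: power2_eq_square)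
    then show ?thesis using assms(1) by simp
  qed
  then have "ternary_det n A C B s r = 1" using assms(1) by simp
  moreover have "n * A - r^2 > 0" using A assms(2) by linarith
  ultimately have "\<exists>u v w. ternary_form n A C B s r 1 0 0 = u^2 + v^2 + w^2"
    using unimodular_ternary_form_sum_of_three_squares assms(1) by blast
  then show ?thesis by (simp add: ternary_form_def)
qed

section \<open>The hyperbola method\<close>

lemma abel_summation_bound:
  fixes g w :: "nat \<Rightarrow> real"
  assumes bound: "\<And>n. \<bar>\<Sum>k<n. g k\<bar> \<le> B"
    and antimono: "\<And>k. k \<ge> u \<Longrightarrow> w (Suc k) \<le> w k"
    and nonneg: "\<And>k. k \<ge> u \<Longrightarrow> 0 \<le> w k"
  shows "\<bar>\<Sum>k=u..<v. g k * w k\<bar> \<le> 2 * B * w u"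
proof (cases "u \<le> v")
  case True
  define G where "G n = (\<Sum>k<n. g k)" for n
  have G: "\<bar>G n\<bar> \<le> B" for n using bound by (simp add: G_def)
  have "0 \<le> B" using bound[of 0] by simp
  have "(\<Sum>k=u..<v. g k * w k) = G v * w v - G u * w u + (\<Sum>k=u..<v. G (Suc k) * (w k - w (Suc k)))
     \<and> (\<Sum>k=u..<v. w k - w (Suc k)) = w u - w v"
    using True
  proof (induction v rule: dec_induct)
    case base
    then show ?case by simp
  next
    case (step n)
    then show ?case by (simp add: G_def algebra_simps)
  qed
  then have eq: "(\<Sum>k=u..<v. g k * w k) = G v * w v - G u * w u + (\<Sum>k=u..<v. G (Suc k) * (w k - w (Suc k)))"
    and telescope: "(\<Sum>k=u..<v. w k - w (Suc k)) = w u - w v"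
    by blast+
  have "\<bar>\<Sum>k=u..<v. G (Suc k) * (w k - w (Suc k))\<bar> \<le> (\<Sum>k=u..<v. B * (w k - w (Suc k)))"
    using G antimono \<open>0 \<le> B\<close> by (intro sum_abs[THEN order_trans] sum_mono) (auto simp: abs_mult intro!: mult_mono)
  also have "\<dots> = B * w u - B * w v"
    unfolding sum_distrib_left[symmetric] telescope by (rule right_diff_distrib)
  finally have "\<bar>\<Sum>k=u..<v. G (Suc k) * (w k - w (Suc k))\<bar> \<le> B * w u - B * w v" .
  moreover have "\<bar>G v * w v\<bar> \<le> B * w v" "\<bar>G u * w u\<bar> \<le> B * w u"
    using G nonneg True \<open>0 \<le> B\<close> by (auto simp: abs_mult intro!: mult_mono)
  ultimately show ?thesis
    unfolding eq by linarith
next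
  case False
  have "0 \<le> B" using bound[of 0] by simp
  then show ?thesis using False nonneg[of u] by simp
qed

lemma sum_inverse_sqrt_le: "(\<Sum>a=1..K. 1 / sqrt (real a)) \<le> 2 * sqrt (real K)"
proof (induction K)
  case (Suc K)
  define s t where "s = sqrt (real K)" and "t = sqrt (real (Suc K))"
  have st: "s * s = real K" "t * t = real K + 1" "0 \<le> s" "0 < t"
    by (auto simp: s_def t_def)
  have "0 \<le> (t - s)^2" by simp
  then have "2 * s * t + 1 \<le> 2 * t * t" using st by (simp add: power2_eq_square algebra_simps)
  then have "2 * s + 1 / t \<le> 2 * t" using st by (simp add: field_simps)
  moreover have "(\<Sum>a=1..Suc K. 1 / sqrt (real a)) \<le> 2 * s + 1 / t"
    using Suc by (simp add: s_def t_def)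
  ultimately show ?case unfolding t_def by linarith
qed simp

definition hyperbola :: "nat \<Rightarrow> (nat \<times> nat) set" where
  "hyperbola K = {(a, b). 1 \<le> a \<and> 1 \<le> b \<and> a * b \<le> K^2}"

lemma finite_hyperbola [simp]: "finite (hyperbola K)"
proof -
  have "hyperbola K \<subseteq> {..K^2} \<times> {..K^2}"
    unfolding hyperbola_def
    by clarsimp (metis One_nat_def Suc_leD le_trans mult.commute mult_le_mono1 nat_mult_1 Suc_le_eq mult.right_neutral mult_le_mono2)
  then show ?thesis by (rule finite_subset) auto
qed

text \<open>For fixed \<open>a\<close>, Abel summation bounds the sum over \<open>b > K\<close> by a
  multiple of B / sqrt K; summing 1 / sqrt a over a \<le> K costs at most 2 sqrt K, so K
  cancels.\<close>

lemma hyperbola_tail_bound: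
  fixes f g :: "nat \<Rightarrow> real"
  assumes bg: "\<And>n. \<bar>\<Sum>k<n. g k\<bar> \<le> B" and f: "\<And>n. \<bar>f n\<bar> \<le> 1"
  shows "\<bar>\<Sum>a=1..K. \<Sum>b=K+1..K^2 div a. f a * g b / sqrt (real (a * b))\<bar> \<le> 4 * B"
proof (cases "K = 0")
  case False
  have B: "0 \<le> B" using bg[of 0] by simp
  have inner: "\<bar>\<Sum>b=K+1..n. g b / sqrt (real b)\<bar> \<le> 2 * B / sqrt (real K)" for n
  proof -
    have "\<bar>\<Sum>b=K+1..<Suc n. g b * (1 / sqrt (real b))\<bar> \<le> 2 * B * (1 / sqrt (real (K+1)))"
      by (rule abel_summation_bound[OF bg]) (auto intro!: divide_left_mono)
    also have "\<dots> \<le> 2 * B * (1 / sqrt (real K))"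
      using B False by (intro mult_left_mono divide_left_mono) auto
    finally show ?thesis by (simp add: atLeastLessThanSuc_atLeastAtMost)
  qed
  have "\<bar>\<Sum>a=1..K. \<Sum>b=K+1..K^2 div a. f a * g b / sqrt (real (a * b))\<bar>
      = \<bar>\<Sum>a=1..K. f a / sqrt (real a) * (\<Sum>b=K+1..K^2 div a. g b / sqrt (real b))\<bar>"
    by (simp add: sum_distrib_left real_sqrt_mult)
  also have "\<dots> \<le> (\<Sum>a=1..K. 1 / sqrt (real a) * (2 * B / sqrt (real K)))"
  proof (intro sum_abs[THEN order_trans] sum_mono)
    fix a
    show "\<bar>f a / sqrt (real a) * (\<Sum>b=K+1..K^2 div a. g b / sqrt (real b))\<bar>
        \<le> 1 / sqrt (real a) * (2 * B / sqrt (real K))"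
      unfolding abs_mult abs_divide using f[of a]
      by (intro mult_mono inner) (auto intro: divide_right_mono)
  qed
  also have "\<dots> = (\<Sum>a=1..K. 1 / sqrt (real a)) * (2 * B / sqrt (real K))"
    by (rule sum_distrib_right[symmetric])
  also have "\<dots> \<le> 2 * sqrt (real K) * (2 * B / sqrt (real K))"
    using B by (intro mult_right_mono sum_inverse_sqrt_le) auto
  also have "\<dots> = 4 * B" using False by simp
  finally show ?thesis .
qed (use bg[of 0] in simp)

text \<open>Cutting the region at K leaves the square a, b \<le> K, where the sum factors, and two
  tails with exactly one variable above K, interchanged by swapping \<open>f\<close> and
  \<open>g\<close>.\<close>

lemma hyperbola_sum_bound:
  fixes f g :: "nat \<Rightarrow> real"
  assumes bf: "\<And>n. \<bar>\<Sum>k<n. f k\<bar> \<le> B" and bg: "\<And>n. \<bar>\<Sum>k<n. g k\<bar> \<le> B"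
    and f: "\<And>n. \<bar>f n\<bar> \<le> 1" and g: "\<And>n. \<bar>g n\<bar> \<le> 1"
  shows "\<bar>\<Sum>(a, b)\<in>hyperbola K. f a * g b / sqrt (real (a * b))\<bar> \<le> 8 * B + 4 * B^2"
proof -
  let ?h = "\<lambda>a b. f a * g b / sqrt (real (a * b))"
  define Q1 where "Q1 = {1..K} \<times> {1..K}"
  define Q2 where "Q2 = (SIGMA a:{1..K}. {K+1..K^2 div a})"
  define Q3 where "Q3 = (\<lambda>(a,b). (b,a)) ` Q2"
  have split: "hyperbola K = Q1 \<union> Q2 \<union> Q3"
  proof -
    have "(a, b) \<in> hyperbola K \<longleftrightarrow> (a, b) \<in> Q1 \<union> Q2 \<union> Q3" for a b
    proof (cases "a \<le> K \<or> b \<le> K")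
      case False
      then have "K * K < a * b" by (intro mult_strict_mono) auto
      with False show ?thesis
        by (auto simp: hyperbola_def Q1_def Q2_def Q3_def power2_eq_square)
    next
      case True
      have le: "a * b \<le> K * K" if "a \<le> K" "b \<le> K" using that by (intro mult_mono) auto
      have "a * b \<le> K^2 \<longleftrightarrow> b \<le> K^2 div a" if "1 \<le> a"
        using that by (simp add: less_eq_div_iff_mult_less_eq mult.commute)
      moreover have "a * b \<le> K^2 \<longleftrightarrow> a \<le> K^2 div b" if "1 \<le> b"
        using that by (simp add: less_eq_div_iff_mult_less_eq mult.commute)
      ultimately show ?thesis using True le
        by (auto simp: hyperbola_def Q1_def Q2_def Q3_def power2_eq_square image_iff)
    qed
    then show ?thesis by auto
  qed
  have fin: "finite Q1" "finite Q2" "finite Q3" by (auto simp: Q1_def Q2_def Q3_def)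
  have disj: "(Q1 \<union> Q2) \<inter> Q3 = {}" "Q1 \<inter> Q2 = {}" by (auto simp: Q1_def Q2_def Q3_def)
  have "(\<Sum>(a, b)\<in>hyperbola K. ?h a b) =
      (\<Sum>(a, b)\<in>Q1. ?h a b) + (\<Sum>(a, b)\<in>Q2. ?h a b) + (\<Sum>(a, b)\<in>Q3. ?h a b)"
    unfolding split using fin disj by (simp add: sum.union_disjoint)
  moreover have "\<bar>\<Sum>(a, b)\<in>Q1. ?h a b\<bar> \<le> 4 * B^2"
  proof -
    have s: "\<bar>\<Sum>a=1..K. F a / sqrt (real a)\<bar> \<le> 2 * B" if "\<And>n. \<bar>\<Sum>k<n. F k\<bar> \<le> B" for F
      using abel_summation_bound[OF that, of 1 "\<lambda>a. 1 / sqrt (real a)" "Suc K"]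
      by (simp add: atLeastLessThanSuc_atLeastAtMost divide_left_mono)
    have "(\<Sum>(a, b)\<in>Q1. ?h a b) = (\<Sum>a=1..K. f a / sqrt (real a)) * (\<Sum>b=1..K. g b / sqrt (real b))"
      unfolding Q1_def by (simp add: sum_product sum.cartesian_product real_sqrt_mult)
    also have "\<bar>\<dots>\<bar> \<le> (2 * B) * (2 * B)"
      unfolding abs_mult using s[OF bf] s[OF bg] by (intro mult_mono) auto
    finally show ?thesis by (simp add: power2_eq_square)
  qed
  moreover have "\<bar>\<Sum>(a, b)\<in>Q2. ?h a b\<bar> \<le> 4 * B"
    using hyperbola_tail_bound[OF bg f] unfolding Q2_def by (simp add: sum.Sigma)
  moreover have "\<bar>\<Sum>(a, b)\<in>Q3. ?h a b\<bar> \<le> 4 * B"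
  proof -
    have "(\<Sum>(a, b)\<in>Q3. ?h a b) = (\<Sum>(a, b)\<in>Q2. g a * f b / sqrt (real (a * b)))"
      unfolding Q3_def by (subst sum.reindex) (auto simp: inj_on_def case_prod_unfold mult.commute)
    also have "\<bar>\<dots>\<bar> \<le> 4 * B"
      using hyperbola_tail_bound[OF bf g] unfolding Q2_def by (simp add: sum.Sigma)
    finally show ?thesis .
  qed
  ultimately show ?thesis by linarith
qed

lemma sum_hyperbola_divisors:
  fixes h :: "nat \<Rightarrow> nat \<Rightarrow> real"
  shows "(\<Sum>(a, b)\<in>hyperbola K. h a b) = (\<Sum>q=1..K^2. \<Sum>d | d dvd q. h (q div d) d)"
proof -
  have "(\<Sum>q=1..K^2. \<Sum>d | d dvd q. h (q div d) d) =
      (\<Sum>(q, d)\<in>(SIGMA q:{1..K^2}. {d. d dvd q}). h (q div d) d)"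
    by (subst sum.Sigma) auto
  also have "\<dots> = (\<Sum>(a, b)\<in>hyperbola K. h a b)"
    by (rule sum.reindex_bij_witness[of _ "\<lambda>(a, b). (a * b, b)" "\<lambda>(q, d). (q div d, d)"])
      (auto simp: hyperbola_def dvd_div_eq_0_iff Suc_le_eq dvd_pos_nat intro: Nat.gr0I)
  finally show ?thesis ..
qed

section \<open>Divisor sums of real characters\<close>

locale real_character =
  fixes f :: "nat \<Rightarrow> real"
  assumes mult: "f (a * b) = f a * f b"
    and one: "f 1 = 1"
    and char_values: "f a \<in> {-1, 0, 1}"
begin

definition divisor_sum :: "nat \<Rightarrow> real" where
  "divisor_sum q = (\<Sum>d | d dvd q. f d)"

lemma power: "f (a ^ k) = f a ^ k"
  by (induction k) (use one mult in auto)

text \<open>Splits off one prime at a time; nonnegativity, the bound on squares and the analysis of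
  nonzero values all follow by strong induction along this factorization.\<close>

lemma divisor_sum_prime_power_times:
  assumes p: "prime p" and u: "\<not> p dvd u" "u > 0"
  shows "divisor_sum (p ^ k * u) = (\<Sum>j\<le>k. f p ^ j) * divisor_sum u"
proof -
  have cop: "coprime p u" using p u prime_imp_coprime by blast
  have "divisor_sum (p ^ k * u) = (\<Sum>(j, d)\<in>{..k} \<times> {d. d dvd u}. f (p ^ j * d))"
    unfolding divisor_sum_def
  proof (rule sum.reindex_bij_betw[symmetric, of "\<lambda>(j, d). p ^ j * d", THEN trans])
    show "bij_betw (\<lambda>(j, d). p ^ j * d) ({..k} \<times> {d. d dvd u}) {d. d dvd p ^ k * u}"
    proof (rule bij_betwI')
      fix x y assume x: "x \<in> {..k} \<times> {d. d dvd u}" and y: "y \<in> {..k} \<times> {d. d dvd u}"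
      obtain j d j' d' where xy: "x = (j, d)" "y = (j', d')" by (cases x, cases y)
      have *: "multiplicity p (p ^ i * e) = i" "\<not> p dvd e" if "e dvd u" for i e
      proof -
        show "\<not> p dvd e" using that u by (meson dvd_trans)
        then show "multiplicity p (p ^ i * e) = i"
          using p by (intro multiplicity_eqI) auto
      qed
      show "((\<lambda>(j, d). p ^ j * d) x = (\<lambda>(j, d). p ^ j * d) y) = (x = y)"
      proof
        assume "(\<lambda>(j, d). p ^ j * d) x = (\<lambda>(j, d). p ^ j * d) y"
        then have eq: "p ^ j * d = p ^ j' * d'" using xy by simp
        then have "j = j'" using *(1)[of d j] *(1)[of d' j'] x y xy by simp
        then show "x = y" using eq p xy by (auto simp: prime_gt_0_nat)
      qed simp
    next
      fix x assume "x \<in> {..k} \<times> {d. d dvd u}"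
      then show "(\<lambda>(j, d). p ^ j * d) x \<in> {d. d dvd p ^ k * u}"
        by (auto intro!: mult_dvd_mono le_imp_power_dvd)
    next
      fix y assume "y \<in> {d. d dvd p ^ k * u}"
      then obtain e d where "y = e * d" "e dvd p ^ k" "d dvd u"
        using division_decomp by blast
      moreover from this obtain i where "i \<le> k" "e = p ^ i"
        using p divides_primepow_nat by blast
      ultimately show "\<exists>x\<in>{..k} \<times> {d. d dvd u}. y = (\<lambda>(j, d). p ^ j * d) x"
        by (intro bexI[of _ "(i, d)"]) auto
    qed
  qed (simp add: case_prod_unfold)
  also have "\<dots> = (\<Sum>j\<le>k. f p ^ j) * divisor_sum u"
    unfolding divisor_sum_def sum_product sum.cartesian_product
    by (simp add: mult power case_prod_unfold)
  finally show ?thesis .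
qed

lemma geometric_sum:
  shows "(\<Sum>j\<le>k. f p ^ j) \<ge> 0"
    and "even k \<Longrightarrow> (\<Sum>j\<le>k. f p ^ j) \<ge> 1"
    and "odd k \<Longrightarrow> f p = -1 \<Longrightarrow> (\<Sum>j\<le>k. f p ^ j) = 0"
proof -
  have 1: "(\<Sum>j\<le>k. (-1 :: real) ^ j) = (if even k then 1 else 0)" by (induction k) auto
  have 0: "(\<Sum>j\<le>k. (0 :: real) ^ j) = 1" by (induction k) auto
  show "(\<Sum>j\<le>k. f p ^ j) \<ge> 0" "even k \<Longrightarrow> (\<Sum>j\<le>k. f p ^ j) \<ge> 1"
    using char_values[of p] 1 0 by auto
  show "odd k \<Longrightarrow> f p = -1 \<Longrightarrow> (\<Sum>j\<le>k. f p ^ j) = 0"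
    using 1 by simp
qed

lemma divisor_sum_1 [simp]: "divisor_sum 1 = 1"
  unfolding divisor_sum_def using one by simp

lemma prime_power_decomposition:
  fixes q :: nat
  assumes "q > 1"
  obtains p k u where "prime p" "k > 0" "\<not> p dvd u" "u > 0" "u < q" "q = p ^ k * u"
proof -
  obtain p where p: "prime p" "p dvd q" using assms prime_factor_nat by (metis less_numeral_extra(4))
  obtain u where u: "q = p ^ multiplicity p q * u" "\<not> p dvd u"
    using multiplicity_decompose'[of q p] p assms not_prime_unit by (metis not_less0)
  have k: "multiplicity p q > 0" using p assms by (simp add: prime_multiplicity_gt_zero_iff)
  have "u > 0" using u assms by (intro Nat.gr0I) auto
  moreover have "1 < p ^ multiplicity p q" using p k by (metis one_less_power prime_gt_1_nat)
  ultimately have "u < q" using u(1) by (metis mult_1 mult_less_mono1)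
  then show ?thesis using that p k u \<open>u > 0\<close> by blast
qed

lemma divisor_sum_nonneg: "q > 0 \<Longrightarrow> divisor_sum q \<ge> 0"
proof (induction q rule: less_induct)
  case (less q)
  show ?case
  proof (cases "q = 1")
    case False
    then have "q > 1" using less.prems by simp
    then obtain p k u where "prime p" "\<not> p dvd u" "u > 0" "u < q" "q = p ^ k * u"
      by (rule prime_power_decomposition)
    then show ?thesis
      using less.IH[of u] geometric_sum(1) by (simp add: divisor_sum_prime_power_times)
  qed (use divisor_sum_1 in simp)
qed

lemma divisor_sum_square: "s > 0 \<Longrightarrow> divisor_sum (s^2) \<ge> 1"
proof (induction s rule: less_induct)
  case (less q)
  show ?case
  proof (cases "q = 1")
    case False
    then have "q > 1" using less.prems by simp
    then obtain p k u where *: "prime p" "\<not> p dvd u" "u > 0" "u < q" "q = p ^ k * u"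
      by (rule prime_power_decomposition)
    have "q^2 = p ^ (2 * k) * u^2"
      by (simp only: *(5) power_mult_distrib power_even_eq)
    moreover have "\<not> p dvd u^2" using * prime_dvd_power by blast
    ultimately have "divisor_sum (q^2) = (\<Sum>j\<le>2 * k. f p ^ j) * divisor_sum (u^2)"
      using * by (simp add: divisor_sum_prime_power_times)
    moreover have "1 * 1 \<le> (\<Sum>j\<le>2 * k. f p ^ j) * divisor_sum (u^2)"
      using less.IH[of u] * geometric_sum(2)[of "2 * k" p] by (intro mult_mono) auto
    ultimately show ?thesis by simp
  qed (use divisor_sum_1 in simp)
qed

text \<open>A prime with \<open>f p = -1\<close> and odd exponent contributes a vanishing geometric
  sum, so in a number with positive divisor sum such primes lie entirely in the square part.\<close>

lemma divisor_sum_pos_imp: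
  assumes "q > 0" "divisor_sum q > 0"
  shows "\<exists>q0 s. q = q0 * s^2 \<and> squarefree q0 \<and> (\<forall>p. prime p \<longrightarrow> p dvd q0 \<longrightarrow> f p \<noteq> -1)"
  using assms
proof (induction q rule: less_induct)
  case (less q)
  show ?case
  proof (cases "q = 1")
    case True
    then show ?thesis using squarefree_1[where 'a = nat] by (intro exI[of _ 1]) auto
  next
    case False
    then have "q > 1" using less.prems by simp
    then obtain p k u where *: "prime p" "\<not> p dvd u" "u > 0" "u < q" "q = p ^ k * u"
      by (rule prime_power_decomposition)
    have pos: "(\<Sum>j\<le>k. f p ^ j) * divisor_sum u > 0"
      using * less.prems by (simp add: divisor_sum_prime_power_times)
    then have "divisor_sum u > 0" and neq: "(\<Sum>j\<le>k. f p ^ j) \<noteq> 0"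
      using divisor_sum_nonneg[of u] * by (auto simp: zero_less_mult_iff)
    then obtain u0 s where u: "u = u0 * s^2" "squarefree u0" "\<And>r. prime r \<Longrightarrow> r dvd u0 \<Longrightarrow> f r \<noteq> -1"
      using less.IH * by blast
    show ?thesis
    proof (cases "even k")
      case True
      then obtain i where "k = 2 * i" by blast
      then have "q = p ^ (2 * i) * (u0 * s^2)" using *(5) u(1) by simp
      then have "q = u0 * (s * p ^ i)^2"
        by (simp add: power_mult_distrib mult_ac flip: power_mult)
      then show ?thesis using u by blast
    next
      case False
      then obtain i where "k = 2 * i + 1" using oddE by blast
      then have "q = p * p ^ (2 * i) * (u0 * s^2)" using *(5) u(1) by simp
      then have "q = (p * u0) * (s * p ^ i)^2"
        by (simp add: power_mult_distrib mult_ac flip: power_mult)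
      moreover have "f p \<noteq> -1" using geometric_sum(3) False neq by blast
      moreover have "coprime p u0"
        using * u(1) by (metis dvd_mult2 prime_imp_coprime)
      then have "squarefree (p * u0)"
        using u(2) *(1) squarefree_mult_coprime squarefree_prime by blast
      moreover have "f r \<noteq> -1" if "prime r" "r dvd p * u0" for r
        using that u(3)[of r] *(1) \<open>f p \<noteq> -1\<close> primes_dvd_imp_eq[of r p]
        by (auto simp: prime_dvd_mult_iff)
      ultimately show ?thesis by blast
    qed
  qed
qed

end

section \<open>Numbers with prescribed real characters\<close>

text \<open>Real characters mod \<open>M\<close>, described by their values on units.
  \<open>independent\<close> says that no nonempty subproduct is principal, which gives cancellation
  over a period.\<close>

locale character_family =
  fixes M :: nat and I :: "'i set" and \<psi> :: "'i \<Rightarrow> nat \<Rightarrow> int"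
  assumes M: "M > 0" and fin: "finite I" and nonempty: "I \<noteq> {}"
    and char_mult: "i \<in> I \<Longrightarrow> coprime j M \<Longrightarrow> coprime k M \<Longrightarrow> \<psi> i (j * k) = \<psi> i j * \<psi> i k"
    and periodic: "i \<in> I \<Longrightarrow> \<psi> i (k mod M) = \<psi> i k"
    and unit: "i \<in> I \<Longrightarrow> coprime k M \<Longrightarrow> \<bar>\<psi> i k\<bar> = 1"
    and independent: "T \<subseteq> I \<Longrightarrow> T \<noteq> {} \<Longrightarrow> \<exists>u. coprime u M \<and> (\<Prod>i\<in>T. \<psi> i u) = -1"
begin

text \<open>The subproduct over \<open>T\<close> as a Dirichlet character, extended by 0 off the
  units; \<open>F {}\<close> is the principal character.\<close>

definition F :: "'i set \<Rightarrow> nat \<Rightarrow> real" where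
  "F T k = (if coprime k M then of_int (\<Prod>i\<in>T. \<psi> i k) else 0)"

lemma abs_char_prod: "T \<subseteq> I \<Longrightarrow> coprime k M \<Longrightarrow> \<bar>\<Prod>i\<in>T. \<psi> i k\<bar> = 1"
  using unit by (simp add: abs_prod subset_iff)

lemma F_mult:
  assumes "T \<subseteq> I" shows "F T (j * k) = F T j * F T k"
  using assms char_mult by (auto simp: F_def prod.distrib[symmetric] subset_iff intro!: prod.cong)

lemma F_abs_le: "T \<subseteq> I \<Longrightarrow> \<bar>F T k\<bar> \<le> 1"
  using abs_char_prod[of T k] unfolding F_def by (auto simp del: of_int_prod simp flip: of_int_abs)

lemma F_one: "T \<subseteq> I \<Longrightarrow> F T 1 = 1"
proof -
  assume T: "T \<subseteq> I"
  have "\<psi> i 1 = 1" if "i \<in> I" for i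
    using char_mult[OF that, of 1 1] unit[OF that, of 1] by (auto simp: abs_if split: if_splits)
  then show ?thesis using T by (auto simp: F_def intro!: prod.neutral)
qed

lemma F_periodic: "T \<subseteq> I \<Longrightarrow> F T (k mod M) = F T k"
  using periodic M by (auto simp: F_def subset_iff intro!: prod.cong)

text \<open>Multiplication by a unit \<open>u\<close> with value -1 permutes the residues and
  negates the sum.\<close>

lemma F_period_sum:
  assumes "T \<subseteq> I" "T \<noteq> {}"
  shows "(\<Sum>k<M. F T k) = 0"
proof -
  obtain u where u: "coprime u M" "(\<Prod>i\<in>T. \<psi> i u) = -1"
    using independent assms by blast
  have inj: "inj_on (\<lambda>k. u * k mod M) {..<M}"
  proof (rule inj_onI)
    fix x y assume xy: "x \<in> {..<M}" "y \<in> {..<M}" "u * x mod M = u * y mod M"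
    then have "[u * x = u * y] (mod M)" by (simp add: cong_def)
    then have "[x = y] (mod M)" using u(1) by (simp add: cong_mult_lcancel_nat)
    then show "x = y" using xy by (simp add: cong_def)
  qed
  have "(\<lambda>k. u * k mod M) ` {..<M} = {..<M}"
    using inj M by (intro endo_inj_surj) auto
  then have "(\<Sum>k<M. F T k) = (\<Sum>k<M. F T (u * k mod M))"
    using sum.reindex[OF inj, of "F T"] by simp
  also have "\<dots> = (\<Sum>k<M. - F T k)"
    using assms u by (simp add: F_periodic F_mult) (simp add: F_def)
  finally show ?thesis by (simp add: sum_negf)
qed

lemma F_partial_sum:
  assumes "T \<subseteq> I" "T \<noteq> {}"
  shows "\<bar>\<Sum>k<n. F T k\<bar> \<le> M"
proof -
  have "(\<Sum>k<n div M * M. F T k) = (\<Sum>m<n div M. \<Sum>k=m*M..<m*M+M. F T k)"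
    by (rule sum.nat_group[symmetric])
  also have "\<dots> = (\<Sum>m<n div M. \<Sum>k<M. F T k)"
  proof (rule sum.cong[OF refl])
    fix m
    have "(\<Sum>k=m*M..<m*M+M. F T k) = (\<Sum>k<M. F T (k + m * M))"
      using sum.shift_bounds_nat_ivl[of "F T" 0 "m * M" M] by (simp add: add.commute lessThan_atLeast0)
    also have "\<dots> = (\<Sum>k<M. F T k)"
      using F_periodic[OF assms(1)] by (metis mod_mult_self1 mult.commute)
    finally show "(\<Sum>k=m*M..<m*M+M. F T k) = (\<Sum>k<M. F T k)" .
  qed
  also have "\<dots> = 0" using F_period_sum[OF assms] by simp
  finally have 0: "(\<Sum>k<n div M * M. F T k) = 0" .
  have "{..<n} = {..<n div M * M} \<union> {n div M * M..<n}"
    by (auto intro: less_le_trans[OF _ div_times_less_eq_dividend])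
  then have "(\<Sum>k<n. F T k) = (\<Sum>k=n div M * M..<n. F T k)"
    using 0 by (simp add: sum.union_disjoint ivl_disj_int)
  also have "\<bar>\<dots>\<bar> \<le> (\<Sum>k=n div M * M..<n. 1)"
    using F_abs_le[OF assms(1)] by (intro sum_abs[THEN order_trans] sum_mono)
  also have "\<dots> = real (n mod M)" by (simp add: minus_div_mult_eq_mod)
  also have "\<dots> \<le> M" using M by (simp add: less_imp_le)
  finally show ?thesis .
qed

sublocale real_character "F I"
proof
  show "F I (a * b) = F I a * F I b" for a b by (simp add: F_mult)
  show "F I 1 = 1" by (rule F_one) simp
  show "F I a \<in> {-1, 0, 1}" for a
    using abs_char_prod[of I a] by (auto simp: F_def abs_if simp del: of_int_prod split: if_splits)
qed

text \<open>Real characters square to 1 on units, so twisting the divisor sum of \<open>F I\<close>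
  by \<open>F T\<close> gives the convolution of \<open>F T\<close> and \<open>F (I - T)\<close>.
  For T other than {} and I both factors are nonprincipal and the hyperbola bound applies.\<close>

lemma F_split:
  assumes "T \<subseteq> I"
  shows "F T (a * b) * F I b = F T a * F (I - T) b"
proof -
  have "F T b * F I b = F (I - T) b"
  proof (cases "coprime b M")
    case True
    have "(\<Prod>i\<in>I. \<psi> i b) = (\<Prod>i\<in>T. \<psi> i b) * (\<Prod>i\<in>I - T. \<psi> i b)"
      using prod.subset_diff[OF assms fin, of "\<lambda>i. \<psi> i b"] by (simp add: mult.commute)
    moreover have "(\<Prod>i\<in>T. \<psi> i b) * (\<Prod>i\<in>T. \<psi> i b) = 1"
      using abs_char_prod[OF assms True] by (auto simp: abs_if split: if_splits)
    ultimately show ?thesis using True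
      by (simp add: F_def mult.assoc[symmetric] del: of_int_prod flip: of_int_mult)
  qed (simp add: F_def)
  then show ?thesis using assms by (simp add: F_mult)
qed

section \<open>Growth of the twisted divisor sums\<close>

definition S :: "'i set \<Rightarrow> nat \<Rightarrow> real" where
  "S T K = (\<Sum>(a, b)\<in>hyperbola K. F T (a * b) * F I b / sqrt (real (a * b)))"

lemma S_bounded:
  assumes "T \<subseteq> I" "T \<noteq> {}" "T \<noteq> I"
  shows "\<bar>S T K\<bar> \<le> 8 * real M + 4 * real M ^ 2"
proof -
  have "S T K = (\<Sum>(a, b)\<in>hyperbola K. F T a * F (I - T) b / sqrt (real (a * b)))"
    unfolding S_def using F_split[OF assms(1)] by simp
  also have "\<bar>\<dots>\<bar> \<le> 8 * real M + 4 * real M ^ 2"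
    using assms by (intro hyperbola_sum_bound F_partial_sum F_abs_le) auto
  finally show ?thesis .
qed

text \<open>For \<open>I\<close> and \<open>{}\<close> the same two characters are convolved in
  opposite order, and the hyperbola is symmetric.\<close>

lemma S_I: "S I K = S {} K"
proof -
  have "S I K = (\<Sum>(a, b)\<in>hyperbola K. F I a * F {} b / sqrt (real (a * b)))"
    by (simp only: S_def F_split[OF subset_refl] Diff_cancel)
  also have "\<dots> = (\<Sum>(a, b)\<in>hyperbola K. F {} a * F I b / sqrt (real (a * b)))"
    by (rule sum.reindex_bij_witness[of _ prod.swap prod.swap])
      (auto simp: hyperbola_def mult.commute)
  also have "\<dots> = S {} K"
    by (simp only: S_def F_split[OF empty_subsetI] Diff_empty)
  finally show ?thesis .
qed

lemma S_divisor_sum: "S T K = (\<Sum>q=1..K^2. F T q * divisor_sum q / sqrt (real q))"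
  unfolding S_def sum_hyperbola_divisors divisor_sum_def
  by (intro sum.cong refl) (auto simp: sum_distrib_left sum_divide_distrib intro!: sum.cong)

text \<open>All terms are nonnegative, so it suffices to keep the squares of the numbers 1 + j M.
  These are prime to \<open>M\<close>, have divisor sum at least 1, and their weights 1 / (1 + j M)
  dominate a multiple of the harmonic series.\<close>

lemma S_empty_unbounded: "\<exists>K. S {} K > C"
proof -
  obtain n where n: "harm n > C * (M + 1)"
    using harm_at_top unfolding filterlim_at_top_dense eventually_sequentially by blast
  define K where "K = 1 + n * M"
  let ?t = "\<lambda>q. F {} q * divisor_sum q / sqrt (real q)"
  have "C < harm n / (real M + 1)" using n by (simp add: pos_less_divide_eq add.commute)
  also have "\<dots> = (\<Sum>j=1..n. 1 / (real j * (real M + 1)))"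
    by (simp add: harm_def sum_divide_distrib field_simps)
  also have "\<dots> \<le> (\<Sum>j=1..n. ?t ((1 + j * M)^2))"
  proof (rule sum_mono)
    fix j assume j: "j \<in> {1..n}"
    have "coprime (1 + j * M) M"
      by (metis add.commute coprime_1_left coprime_mod_left_iff M mod_mult_self1 not_less0)
    then have "F {} ((1 + j * M)^2) = 1" by (simp add: F_def)
    moreover have "divisor_sum ((1 + j * M)^2) \<ge> 1" using divisor_sum_square[of "1 + j * M"] by simp
    then have "1 / (1 + real j * real M) \<le> divisor_sum ((1 + j * M)^2) / (1 + real j * real M)"
      by (intro divide_right_mono) auto
    moreover have "1 / (real j * (real M + 1)) \<le> 1 / (1 + real j * real M)"
      using j M by (intro divide_left_mono) (auto simp: algebra_simps intro!: mult_pos_pos add_pos_nonneg)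
    ultimately show "1 / (real j * (real M + 1)) \<le> ?t ((1 + j * M)^2)"
      by simp
  qed
  also have "\<dots> = (\<Sum>q\<in>(\<lambda>j. (1 + j * M)^2) ` {1..n}. ?t q)"
    using M by (subst sum.reindex) (auto simp: inj_on_def power2_eq_iff)
  also have "\<dots> \<le> (\<Sum>q=1..K^2. ?t q)"
  proof (rule sum_mono2)
    show "(\<lambda>j. (1 + j * M)^2) ` {1..n} \<subseteq> {1..K^2}"
      by (auto simp: K_def intro!: power_mono)
    show "0 \<le> ?t q" if "q \<in> {1..K^2} - (\<lambda>j. (1 + j * M)^2) ` {1..n}" for q
      using that divisor_sum_nonneg[of q] by (simp add: F_def)
  qed simp
  finally show ?thesis unfolding S_divisor_sum by blast
qed

text \<open>\<open>P q\<close> is the product of the 1 + \<epsilon> i \<psi> i(q) and vanishes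
  unless every sign is as prescribed. In the weighted sum of \<open>P\<close>, the subsets {} and I
  give equal unbounded terms, which add up because the signs multiply to 1; the others stay bounded.
  Some term is therefore positive.\<close>

theorem exists_prescribed_signs:
  assumes \<epsilon>: "\<And>i. i \<in> I \<Longrightarrow> \<bar>\<epsilon> i\<bar> = (1 :: int)" "(\<Prod>i\<in>I. \<epsilon> i) = 1"
  shows "\<exists>q. q > 0 \<and> squarefree q \<and> coprime q M \<and> (\<forall>i\<in>I. \<psi> i q = \<epsilon> i) \<and>
    (\<forall>p. prime p \<longrightarrow> p dvd q \<longrightarrow> (\<Prod>i\<in>I. \<psi> i p) = 1)"
proof -
  define E where "E T = real_of_int (\<Prod>i\<in>T. \<epsilon> i)" for T :: "'i set"
  have E: "\<bar>E T\<bar> = 1" if "T \<subseteq> I" for T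
  proof -
    have "\<bar>\<Prod>i\<in>T. \<epsilon> i\<bar> = 1" using \<epsilon>(1) that by (simp add: abs_prod subset_iff)
    then show ?thesis unfolding E_def by (metis of_int_1 of_int_abs)
  qed
  \<comment> \<open>\<open>F {} q\<close> stands in place of 1 so that \<open>P q\<close> is also 0
    when q is not prime to \<open>M\<close>.\<close>
  define P where "P q = (\<Prod>i\<in>I. F {} q + of_int (\<epsilon> i) * F {i} q)" for q
  have P: "P q = (\<Sum>T\<in>Pow I. E T * F T q)" for q
  proof (cases "coprime q M")
    case True
    have "P q = (\<Prod>i\<in>I. of_int (\<epsilon> i * \<psi> i q) + 1)"
      unfolding P_def using True by (simp add: F_def add.commute)
    also have "\<dots> = (\<Sum>T\<in>Pow I. \<Prod>i\<in>T. of_int (\<epsilon> i * \<psi> i q))"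
      using prod_add[OF fin, of "\<lambda>i. of_int (\<epsilon> i * \<psi> i q)" "\<lambda>i. 1 :: real"] by simp
    also have "\<dots> = (\<Sum>T\<in>Pow I. E T * F T q)"
      using True by (simp add: E_def F_def prod.distrib)
    finally show ?thesis .
  next
    case False
    then show ?thesis using fin nonempty by (simp add: P_def F_def card_gt_0_iff)
  qed
  define C where "C = 8 * real M + 4 * real M ^ 2"
  define J where "J = Pow I - {{}, I}"
  obtain K where K: "S {} K > real (card J) * C" using S_empty_unbounded by blast
  have "(\<Sum>q=1..K^2. P q * divisor_sum q / sqrt (real q)) = (\<Sum>T\<in>Pow I. E T * S T K)"
    unfolding P S_divisor_sum sum_distrib_left sum_distrib_right sum_divide_distrib
    by (subst sum.swap) (simp add: mult.assoc)
  also have "\<dots> = E {} * S {} K + E I * S I K + (\<Sum>T\<in>J. E T * S T K)"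
  proof -
    have "Pow I = insert {} (insert I J)" "finite J" "{} \<notin> J" "I \<notin> J"
      using fin unfolding J_def by auto
    then show ?thesis using nonempty by simp
  qed
  also have "\<dots> = 2 * S {} K + (\<Sum>T\<in>J. E T * S T K)"
    using \<epsilon>(2) by (simp add: E_def S_I)
  also have "\<dots> > 0"
  proof -
    have "\<bar>\<Sum>T\<in>J. E T * S T K\<bar> \<le> (\<Sum>T\<in>J. C)"
      using E S_bounded unfolding J_def C_def
      by (intro sum_abs[THEN order_trans] sum_mono) (simp add: abs_mult)
    moreover have "C \<ge> 0" by (simp add: C_def)
    then have "real (card J) * C \<ge> 0" by simp
    ultimately show ?thesis using K unfolding sum_constant by linarith
  qed
  finally have "\<exists>q\<in>{1..K^2}. P q * divisor_sum q / sqrt (real q) > 0"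
    by (meson not_le sum_nonpos)
  then obtain q where "q \<in> {1..K^2}" "P q * divisor_sum q / sqrt (real q) > 0" by blast
  then have q: "q > 0" "P q * divisor_sum q > 0"
    by (auto simp: zero_less_divide_iff)
  then have Pq: "P q \<noteq> 0" and dq: "divisor_sum q > 0"
    using divisor_sum_nonneg[of q] by (auto simp: zero_less_mult_iff)
  have cop: "coprime q M"
    using Pq nonempty fin by (auto simp: P_def F_def)
  have \<psi>: "\<psi> i q = \<epsilon> i" if "i \<in> I" for i
  proof -
    have "1 + of_int (\<epsilon> i * \<psi> i q) \<noteq> (0 :: real)"
      using Pq that fin cop by (auto simp: P_def F_def)
    then have "\<epsilon> i * \<psi> i q \<noteq> -1" by (metis add.right_inverse of_int_1 of_int_minus)
    then show ?thesis using \<epsilon>(1)[OF that] unit[OF that cop] by (auto simp: abs_if split: if_splits)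
  qed
  obtain q0 s where s: "q = q0 * s^2" "squarefree q0"
    "\<And>p. prime p \<Longrightarrow> p dvd q0 \<Longrightarrow> F I p \<noteq> -1"
    using divisor_sum_pos_imp[OF q(1) dq] by blast
  \<comment> \<open>Removing the square part changes no \<psi> i, since each is \<plusminus>1 at
    s.\<close>
  have cop': "coprime q0 M" "coprime s M" using cop s by auto
  have "\<psi> i q0 = \<epsilon> i" if "i \<in> I" for i
  proof -
    have "\<psi> i q = \<psi> i q0 * (\<psi> i s * \<psi> i s)" using s(1) that cop' by (simp add: char_mult power2_eq_square)
    also have "\<psi> i s * \<psi> i s = 1" using unit[OF that cop'(2)] by (auto simp: abs_if split: if_splits)
    finally show ?thesis using \<psi>[OF that] by simp
  qed
  moreover have "(\<Prod>i\<in>I. \<psi> i p) = 1" if p: "prime p" "p dvd q0" for p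
  proof -
    have "coprime p M" using cop'(1) p(2) by (meson coprime_divisors dvd_refl)
    then show ?thesis using s(3)[OF p] abs_char_prod[of I p]
      by (auto simp: F_def abs_if simp del: of_int_prod split: if_splits)
  qed
  moreover have "q0 > 0" using s q by (auto intro: Nat.gr0I)
  ultimately show ?thesis using cop' s(2) by blast
qed

end

section \<open>Legendre symbols\<close>

lemma sqrt_mod_squarefree:
  fixes k :: nat and c :: int
  assumes "squarefree k" "k > 0"
    and "\<And>p. prime p \<Longrightarrow> p dvd k \<Longrightarrow> \<exists>x. int p dvd x^2 + c"
  shows "\<exists>x. int k dvd x^2 + c"
  using assms
proof (induction k rule: less_induct)
  case (less k)
  show ?case
  proof (cases "k = 1")
    case False
    then obtain p where p: "prime p" "p dvd k" using prime_factor_nat by blast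
    then obtain k' where k': "k = p * k'" by blast
    have "\<not> p dvd k'"
    proof
      assume "p dvd k'"
      then have "p^2 dvd k" using k' by (simp add: power2_eq_square mult_dvd_mono)
      then show False using squarefreeD[OF less.prems(1)] p(1) not_prime_unit by blast
    qed
    then have cop: "coprime (int p) (int k')" using p(1) prime_imp_coprime by (simp add: prime_imp_coprime)
    have "k' > 0" "k' < k" using k' less.prems(2) prime_gt_1_nat[OF p(1)] by auto
    moreover have "squarefree k'" using less.prems(1) k' squarefree_multD by blast
    ultimately obtain x1 where x1: "int k' dvd x1^2 + c"
      using less.IH[of k'] less.prems(3) k' by (metis dvd_mult)
    obtain x2 where x2: "int p dvd x2^2 + c" using less.prems(3) p by blast
    obtain x where x: "[x = x2] (mod int p)" "[x = x1] (mod int k')"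
      using binary_chinese_remainder_int[OF cop] by blast
    have "int p dvd x^2 + c"
      using x2 x(1) by (meson cong_add_rcancel cong_dvd_iff cong_pow cong_add cong_refl)
    moreover have "int k' dvd x^2 + c"
      using x1 x(2) by (meson cong_dvd_iff cong_pow cong_add cong_refl)
    ultimately have "int p * int k' dvd x^2 + c" using cop by (simp add: divides_mult)
    then show ?thesis using k' by auto
  qed simp
qed

lemma Legendre_range: "Legendre a p \<in> {-1, 0, 1}"
  by (simp add: Legendre_def)

lemma Legendre_eq_0_iff: "Legendre a p = 0 \<longleftrightarrow> p dvd a"
  by (simp add: Legendre_def cong_0_iff)

lemma Legendre_cong:
  assumes "[a = b] (mod p)" shows "Legendre a p = Legendre b p"
proof -
  have "[a = c] (mod p) \<longleftrightarrow> [b = c] (mod p)" "[c = a] (mod p) \<longleftrightarrow> [c = b] (mod p)" for c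
    using assms by (auto simp: cong_def)
  then show ?thesis unfolding Legendre_def QuadRes_def by presburger
qed

lemma cong_Legendre_imp_eq:
  fixes p :: nat
  assumes "p > 2" "[x = y] (mod int p)" "x \<in> {-1, 0, 1}" "y \<in> {-1, 0, 1 :: int}"
  shows "x = y"
proof (rule ccontr)
  assume "x \<noteq> y"
  moreover have "int p dvd x - y" using assms(2) by (simp add: cong_iff_dvd_diff)
  ultimately have "int p \<le> \<bar>x - y\<bar>" by (simp add: zdvd_imp_le dvd_imp_le_int)
  then show False using assms by auto
qed

lemma Legendre_mult:
  fixes p :: nat
  assumes "prime p" "p > 2"
  shows "Legendre (a * b) p = Legendre a p * Legendre b p"
proof (rule cong_Legendre_imp_eq[OF assms(2)])
  note e = euler_criterion[OF assms]
  have "[Legendre a p * Legendre b p = a ^ ((p - 1) div 2) * b ^ ((p - 1) div 2)] (mod p)"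
    by (rule cong_mult[OF e e])
  moreover have "[Legendre (a * b) p = a ^ ((p - 1) div 2) * b ^ ((p - 1) div 2)] (mod p)"
    using e[of "a * b"] by (simp only: power_mult_distrib)
  ultimately show "[Legendre (a * b) p = Legendre a p * Legendre b p] (mod p)"
    by (meson cong_sym cong_trans)
  show "Legendre a p * Legendre b p \<in> {-1, 0, 1}"
    using Legendre_range[of a p] Legendre_range[of b p] by auto
qed (rule Legendre_range)

lemma Legendre_1 [simp]:
  fixes p :: int
  assumes "p > 1" shows "Legendre 1 p = 1"
proof -
  have "QuadRes p 1" unfolding QuadRes_def by (rule exI[of _ 1]) simp
  moreover have "\<not> p dvd 1" using assms by simp
  ultimately show ?thesis by (simp add: Legendre_def cong_0_iff)
qed

lemma Legendre_eq_1_imp: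
  assumes "Legendre a p = 1" shows "\<exists>x. p dvd x^2 - a"
proof -
  have "QuadRes p a" using assms by (simp add: Legendre_def split: if_splits)
  then show ?thesis by (simp add: QuadRes_def cong_iff_dvd_diff)
qed

text \<open>On odd k, \<open>sign4\<close> and \<open>sign8\<close> are the symbols (-1/k) and
  (2/k); the value -1 on even k is a default.\<close>

definition sign4 :: "nat \<Rightarrow> int" where "sign4 k = (if k mod 4 = 1 then 1 else -1)"
definition sign8 :: "nat \<Rightarrow> int" where "sign8 k = (if k mod 8 \<in> {1, 7} then 1 else -1)"

lemma odd_mod_8:
  assumes "odd (k :: nat)" shows "k mod 8 \<in> {1, 3, 5, 7}"
proof -
  have "k mod 8 = 1 \<or> k mod 8 = 3 \<or> k mod 8 = 5 \<or> k mod 8 = 7"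
    using assms by presburger
  then show ?thesis by simp
qed

lemma sign4_mult: "odd j \<Longrightarrow> odd k \<Longrightarrow> sign4 (j * k) = sign4 j * sign4 k"
proof -
  assume "odd j" "odd k"
  then have "j mod 4 = 1 \<or> j mod 4 = 3" "k mod 4 = 1 \<or> k mod 4 = 3" by presburger+
  moreover have eq: "j * k mod 4 = (j mod 4) * (k mod 4) mod 4" by (rule mod_mult_eq[symmetric])
  ultimately show ?thesis unfolding sign4_def eq by (elim disjE) simp_all
qed

lemma sign8_mult: "odd j \<Longrightarrow> odd k \<Longrightarrow> sign8 (j * k) = sign8 j * sign8 k"
proof -
  assume jk: "odd j" "odd k"
  have eq: "j * k mod 8 = (j mod 8) * (k mod 8) mod 8" by (rule mod_mult_eq[symmetric])
  show ?thesis unfolding sign8_def eq using odd_mod_8[OF jk(1)] odd_mod_8[OF jk(2)]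
    by (elim insertE emptyE) simp_all
qed

lemma sign_prod:
  assumes "finite A" "\<And>l. l \<in> A \<Longrightarrow> odd l"
  shows "odd (\<Prod>A) \<and> sign4 (\<Prod>A) = (\<Prod>l\<in>A. sign4 l) \<and> sign8 (\<Prod>A) = (\<Prod>l\<in>A. sign8 l)"
  using assms
proof (induction A rule: finite_induct)
  case empty
  then show ?case by (simp add: sign4_def sign8_def)
next
  case (insert l A)
  then show ?case by (simp add: sign4_mult sign8_mult)
qed

section \<open>Supplementary laws, reciprocity and nonresidues\<close>

lemma Legendre_minus_1:
  fixes p :: nat
  assumes "prime p" "p > 2"
  shows "Legendre (-1) p = sign4 p"
proof (rule cong_Legendre_imp_eq[OF assms(2)])
  have odd: "odd p" using assms prime_odd_nat by blast
  have "(-1 :: int) ^ ((p - 1) div 2) = sign4 p"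
  proof -
    have "p mod 4 = 1 \<or> p mod 4 = 3" using odd by presburger
    then show ?thesis
    proof
      assume "p mod 4 = 1"
      then have "even ((p - 1) div 2)" by presburger
      then show ?thesis using \<open>p mod 4 = 1\<close> by (simp add: sign4_def)
    next
      assume "p mod 4 = 3"
      then have "odd ((p - 1) div 2)" by presburger
      then show ?thesis using \<open>p mod 4 = 3\<close> by (simp add: sign4_def)
    qed
  qed
  then show "[Legendre (-1) p = sign4 p] (mod int p)"
    using euler_criterion[OF assms, of "-1"] by simp
qed (auto simp: sign4_def Legendre_def)

text \<open>By Gauss's lemma the symbol is the parity of the number of doubles 2, 4, ..., p - 1 that
  exceed (p - 1)/2.\<close>

lemma Legendre_2:
  fixes p :: nat
  assumes "prime p" "p > 2"
  shows "Legendre 2 p = sign8 p"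
proof -
  have odd: "odd p" using assms prime_odd_nat by blast
  interpret GAUSS p 2
    using assms by unfold_locales (auto simp: cong_0_iff dest: zdvd_imp_le)
  define h where "h = (p - 1) div 2"
  have p: "p = 2 * h + 1" using odd unfolding h_def by presburger
  have "E = (\<lambda>x. 2 * int x) ` {h div 2 <.. h}"
  proof -
    have C: "C = (\<lambda>x. 2 * x) ` {0<..int h}"
      unfolding C_def B_def A_def image_image by (intro image_cong) (auto simp: p)
    show ?thesis
    proof (intro equalityI subsetI)
      fix y assume "y \<in> E"
      then obtain x where "0 < x" "x \<le> int h" "y = 2 * x" "2 * x > int h"
        unfolding E_def C by (auto simp: p)
      then show "y \<in> (\<lambda>x. 2 * int x) ` {h div 2 <.. h}"
        by (intro image_eqI[of _ _ "nat x"]) auto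
    next
      fix y assume "y \<in> (\<lambda>x. 2 * int x) ` {h div 2 <.. h}"
      then obtain x where "h div 2 < x" "x \<le> h" "y = 2 * int x" by auto
      then show "y \<in> E"
        unfolding E_def C by (auto simp: p intro!: image_eqI[of _ _ "int x"])
    qed
  qed
  then have "card E = h - h div 2" by (simp add: card_image inj_on_def)
  moreover have "even (h - h div 2) \<longleftrightarrow> p mod 8 \<in> {1, 7}"
  proof -
    have "h mod 4 = 0 \<or> h mod 4 = 1 \<or> h mod 4 = 2 \<or> h mod 4 = 3" by presburger
    moreover have "even (h - h div 2) \<longleftrightarrow> h mod 4 = 0 \<or> h mod 4 = 3" by presburger
    moreover have "p mod 8 = 1 \<longleftrightarrow> h mod 4 = 0" "p mod 8 = 7 \<longleftrightarrow> h mod 4 = 3"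
      unfolding p by presburger+
    ultimately show ?thesis by auto
  qed
  ultimately show ?thesis using gauss_lemma by (simp add: sign8_def)
qed

lemma Legendre_reciprocity:
  fixes p q :: nat
  assumes "prime p" "p > 2" "prime q" "q > 2" "p \<noteq> q"
  shows "Legendre p q = (if p mod 4 = 1 then 1 else sign4 q) * Legendre q p"
proof -
  have odd: "odd p" "odd q" using assms prime_odd_nat by blast+
  then have "even ((p - 1) div 2) \<longleftrightarrow> p mod 4 = 1" "even ((q - 1) div 2) \<longleftrightarrow> q mod 4 = 1"
    by presburger+
  then have "(-1 :: int) ^ ((p - 1) div 2 * ((q - 1) div 2)) = (if p mod 4 = 1 then 1 else sign4 q)"
    by (cases "p mod 4 = 1"; cases "q mod 4 = 1") (simp_all add: sign4_def)
  then have "Legendre p q * Legendre q p = (if p mod 4 = 1 then 1 else sign4 q)"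
    using Quadratic_Reciprocity[OF assms] by simp
  moreover have "\<not> int p dvd int q" using assms primes_dvd_imp_eq by (metis int_dvd_int_iff)
  then have "Legendre q p \<in> {-1, 1}"
    using Legendre_eq_0_iff[of "int q" "int p"] Legendre_range[of "int q" "int p"] by auto
  ultimately show ?thesis by auto
qed

text \<open>Otherwise squaring would be surjective on the residues mod p, hence injective, although
  1 and p - 1 have the same square.\<close>

lemma exists_nonresidue:
  fixes p :: nat
  assumes "prime p" "p > 2"
  shows "\<exists>x::nat. Legendre x p = -1"
proof (rule ccontr)
  assume "\<nexists>x::nat. Legendre x p = -1"
  then have res: "QuadRes p (int x)" if "\<not> p dvd x" for x
    using that by (auto simp: Legendre_def cong_0_iff split: if_splits)
  let ?f = "\<lambda>y::nat. y^2 mod p"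
  have "{..<p} \<subseteq> ?f ` {..<p}"
  proof
    fix x assume x: "x \<in> {..<p}"
    show "x \<in> ?f ` {..<p}"
    proof (cases "x = 0")
      case True
      then show ?thesis using x by (intro image_eqI[of _ _ 0]) auto
    next
      case False
      then have "\<not> p dvd x" using x by (auto dest: dvd_imp_le)
      then obtain y where y: "[y^2 = int x] (mod int p)" using res unfolding QuadRes_def by blast
      define z where "z = nat (y mod int p)"
      have "0 \<le> y mod int p" "y mod int p < int p" using assms by simp_all
      then have z: "int z = y mod int p" "z < p" unfolding z_def by auto
      have "[int z = y] (mod int p)" using z by (simp add: cong_def)
      then have "[int z ^ 2 = int x] (mod int p)" using y cong_pow cong_trans by blast
      then have "[z^2 = x] (mod p)" by (metis cong_int_iff of_nat_power)
      then have "?f z = x" using x by (simp add: cong_def)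
      then show ?thesis using z by blast
    qed
  qed
  moreover have "?f ` {..<p} \<subseteq> {..<p}" using assms by auto
  ultimately have "?f ` {..<p} = {..<p}" by blast
  then have "inj_on ?f {..<p}" by (intro eq_card_imp_inj_on) auto
  moreover have "?f 1 = ?f (p - 1)"
  proof -
    have "(p - 1)^2 = 1 + p * (p - 2)"
    proof -
      obtain m where "p = m + 2" using assms(2) by (metis add.commute le_Suc_ex less_imp_le)
      then show ?thesis by (simp add: power2_eq_square)
    qed
    then have "?f (p - 1) = (1 + p * (p - 2)) mod p" by (simp only:)
    also have "\<dots> = ?f 1" by (simp only: mod_mult_self2 power_one)
    finally show ?thesis ..
  qed
  moreover have "1 \<in> {..<p}" "p - 1 \<in> {..<p}" "1 \<noteq> p - 1" using assms by auto
  ultimately show False by (meson inj_onD)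
qed

section \<open>Sums of three squares\<close>

text \<open>The number is a = \<delta> q with q odd and squarefree. Reciprocity writes (-n/p) as the
  product of a character \<eta> mod 8 and the (p/l) for odd primes l dividing n. So -n is a square
  mod q if this product is 1 on the primes dividing q, and -a is a square mod n if each (q/l) equals
  (-\<delta>/l). The sign at \<eta> is free and makes all signs multiply to 1. For n = 3 mod 8,
  \<eta> is trivial, and \<delta> = 2 ensures this instead.\<close>

lemma auxiliary_number:
  fixes n :: nat
  assumes n: "squarefree n" "n mod 8 \<in> {1, 2, 3, 5, 6}"
  shows "\<exists>a b r :: int. a > 0 \<and> coprime a (int n) \<and> a dvd b^2 + int n \<and> int n dvd r^2 + a"
proof -
  have n0: "n > 0" using n(2) by (auto intro: Nat.gr0I)
  have even_prime: "p = 2" if "prime p" "even p" for p :: nat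
    using that primes_dvd_imp_eq[of 2 p] by simp
  define L where "L = {l. prime l \<and> odd l \<and> l dvd n}"
  have finL: "finite L" using n0 unfolding L_def by (auto intro: finite_subset[of _ "{..n}"] dest: dvd_imp_le)
  have L: "prime l" "odd l" "l > 2" "l dvd n" if "l \<in> L" for l
    using that prime_gt_1_nat[of l] unfolding L_def by (auto simp: le_less elim: oddE)
  define m where "m = \<Prod>L"
  have m: "odd m" "sign4 m = (\<Prod>l\<in>L. sign4 l)" "sign8 m = (\<Prod>l\<in>L. sign8 l)"
    using sign_prod[OF finL] L unfolding m_def by blast+
  have nm: "n = (if even n then 2 else 1) * m"
  proof -
    have "n = \<Prod>(prime_factors n)"
    proof -
      have "n = (\<Prod>p\<in>prime_factors n. p ^ multiplicity p n)"
        using n0 by (simp add: prime_factorization_nat)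
      also have "\<dots> = \<Prod>(prime_factors n)"
        using n(1) n0 squarefree_factorial_semiring'[of n] by (intro prod.cong) auto
      finally show ?thesis .
    qed
    moreover have "prime_factors n = (if even n then {2} else {}) \<union> L"
      using n0 even_prime by (auto simp: L_def in_prime_factors_iff)
    moreover have "2 \<notin> L" by (simp add: L_def)
    ultimately show ?thesis using finL by (auto simp: m_def split: if_splits)
  qed
  have m_odd: "m = n" if "odd n" using nm that by simp
  \<comment> \<open>The part of (-n/p) that depends on p only mod 8: (-1/p), then (2/p) for even n,
    then the sign that reciprocity costs in passing from (m/p) to the (p/l).\<close>
  define \<eta> where "\<eta> k = sign4 k * (if even n then sign8 k else 1) * (if k mod 4 = 1 then 1 else sign4 m)" for k
  define \<delta> :: nat where "\<delta> = (if n mod 8 = 3 then 2 else 1)"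
  have \<eta>_trivial: "\<eta> k = 1" if "n mod 8 = 3" for k
  proof -
    have "odd n" "n mod 4 = 3" using that by presburger+
    then show ?thesis using m_odd by (simp add: \<eta>_def sign4_def)
  qed
  have \<eta>_mult: "\<eta> (j * k) = \<eta> j * \<eta> k" if "odd j" "odd k" for j k
  proof -
    have "j mod 4 = 1 \<or> j mod 4 = 3" "k mod 4 = 1 \<or> k mod 4 = 3" using that by presburger+
    then show ?thesis
      using sign4_mult[OF that] unfolding \<eta>_def sign8_mult[OF that]
      by (auto simp: sign4_def split: if_splits)
  qed
  have \<eta>_cong: "\<eta> j = \<eta> k" if "j mod 8 = k mod 8" for j k
  proof -
    have "j mod 8 mod 4 = k mod 8 mod 4" using that by (simp only:)
    then have "j mod 4 = k mod 4" by (simp add: mod_mod_cancel)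
    then show ?thesis using that by (simp add: \<eta>_def sign4_def sign8_def)
  qed
  have \<eta>_abs: "\<bar>\<eta> k\<bar> = 1" for k by (simp add: \<eta>_def sign4_def sign8_def)
  have \<eta>_1: "\<eta> 1 = 1" by (simp add: \<eta>_def sign4_def sign8_def)
  \<comment> \<open>A unit mod 8 that witnesses the nontriviality of \<eta>.\<close>
  define w :: nat where "w = (if even n then 5 else 3)"
  have \<eta>_w: "\<eta> w = -1" if "n mod 8 \<noteq> 3"
  proof (cases "even n")
    case True
    then show ?thesis by (simp add: \<eta>_def w_def sign4_def sign8_def)
  next
    case False
    then have "n mod 8 = 1 \<or> n mod 8 = 5" using n(2) that odd_mod_8[of n] by auto
    then have "n mod 4 = 1" by presburger
    then have "m mod 4 = 1" using m_odd False by simp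
    then show ?thesis using False by (simp add: \<eta>_def w_def sign4_def)
  qed
  have Legendre_n: "Legendre (- int n) p = \<eta> p * (\<Prod>l\<in>L. Legendre p l)" if p: "prime p" "p > 2" "p \<notin> L" for p
  proof -
    have prod: "Legendre (int (\<Prod>A)) p = (\<Prod>l\<in>A. Legendre l p)" if "finite A" for A
      using that p by (induction A rule: finite_induct) (simp_all add: Legendre_mult)
    have "Legendre (int m) p = (\<Prod>l\<in>L. (if p mod 4 = 1 then 1 else sign4 l) * Legendre p l)"
      unfolding m_def prod[OF finL]
    proof (rule prod.cong[OF refl])
      fix l assume l: "l \<in> L"
      have "odd l" "odd p" using L[OF l] p prime_odd_nat by blast+
      then have "(if l mod 4 = 1 then 1 else sign4 p) = (if p mod 4 = 1 then 1 else sign4 l)"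
        by (simp add: sign4_def)
      moreover have "l \<noteq> p" using l p(3) by blast
      ultimately show "Legendre l p = (if p mod 4 = 1 then 1 else sign4 l) * Legendre p l"
        using Legendre_reciprocity[of l p] L[OF l] p by simp
    qed
    also have "\<dots> = (if p mod 4 = 1 then 1 else sign4 m) * (\<Prod>l\<in>L. Legendre p l)"
      by (simp add: prod.distrib m)
    finally have m': "Legendre (int m) p = (if p mod 4 = 1 then 1 else sign4 m) * (\<Prod>l\<in>L. Legendre p l)" .
    have "- int n = -1 * ((if even n then 2 else 1) * int m)" using nm by (auto split: if_splits)
    then have "Legendre (- int n) p = Legendre (-1) p * (Legendre (if even n then 2 else 1) p * Legendre (int m) p)"
      using p by (simp only: Legendre_mult)
    also have "\<dots> = \<eta> p * (\<Prod>l\<in>L. Legendre p l)"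
      using p by (simp add: Legendre_minus_1 Legendre_2 m' \<eta>_def)
    finally show ?thesis .
  qed
  \<comment> \<open>Each character is indexed by a modulus of it: 8 stands for \<eta>, which is left
    out when trivial so that independence holds.\<close>
  define I where "I = L \<union> (if n mod 8 = 3 then {} else {8})"
  define \<psi> :: "nat \<Rightarrow> nat \<Rightarrow> int" where "\<psi> i k = (if i = 8 then \<eta> k else Legendre k i)" for i k
  have "\<not> prime (8 :: nat)" using even_prime[of 8] by auto
  then have L8: "8 \<notin> L" by (auto simp: L_def)
  have \<psi>L: "\<psi> l k = Legendre k l" if "l \<in> L" for l k using that L8 by (auto simp: \<psi>_def)
  have I8: "I \<subseteq> insert 8 L" by (auto simp: I_def)
  have prod_I: "(\<Prod>i\<in>I. f i) = (if n mod 8 = 3 then 1 else f 8) * (\<Prod>l\<in>L. f l)" for f :: "nat \<Rightarrow> int"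
    using finL L8 by (simp add: I_def)
  have cop_L8: "coprime l 8" if "l \<in> L" for l
  proof -
    have "coprime l (2^3)" using L(2)[OF that] by (subst coprime_power_right_iff) simp
    then show ?thesis by simp
  qed
  have l_dvd_m: "l dvd m" if "l \<in> L" for l
    using dvd_prodI[OF finL that, of "\<lambda>x. x"] by (simp add: m_def)
  have \<psi>_cong: "\<psi> i j = \<psi> i k" if "i \<in> insert 8 L" "[j = k] (mod i)" for i j k
  proof (cases "i = 8")
    case True
    then show ?thesis using that \<eta>_cong[of j k] by (simp add: \<psi>_def cong_def)
  next
    case False
    then have "[int j = int k] (mod int i)" using that by (simp add: cong_int_iff)
    then show ?thesis using False Legendre_cong by (simp add: \<psi>_def)
  qed
  have \<psi>_1: "\<psi> i 1 = 1" if "i \<in> insert 8 L" for i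
    using that \<eta>_1 L(3)[of i] by (auto simp: \<psi>_def)
  interpret character_family "8 * m" I \<psi>
  proof
    show "0 < 8 * m" using m(1) by (auto intro: Nat.gr0I)
    show "finite I" using finL by (simp add: I_def)
    show "I \<noteq> {}"
    proof
      assume "I = {}"
      then have "L = {}" "n mod 8 = 3" by (auto simp: I_def split: if_splits)
      then have "m = 1" by (simp add: m_def)
      then show False using nm \<open>n mod 8 = 3\<close> by (auto split: if_splits)
    qed
  next
    fix i j k assume i: "i \<in> I" and c: "coprime j (8 * m)" "coprime k (8 * m)"
    show "\<psi> i (j * k) = \<psi> i j * \<psi> i k"
    proof (cases "i = 8")
      case True
      have "odd j" "odd k" using c by (auto simp: coprime_def dest!: spec[of _ 2])
      then show ?thesis using True \<eta>_mult by (simp add: \<psi>_def)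
    next
      case False
      then have "i \<in> L" using i I8 by blast
      then show ?thesis using False L by (simp add: \<psi>_def Legendre_mult)
    qed
  next
    fix i k assume i: "i \<in> I"
    then have "i \<in> insert 8 L" using I8 by blast
    moreover have "i dvd 8 * m" using calculation l_dvd_m by auto
    then have "[k mod (8 * m) = k] (mod i)" by (simp add: cong_def mod_mod_cancel)
    ultimately show "\<psi> i (k mod (8 * m)) = \<psi> i k" by (rule \<psi>_cong)
  next
    fix i k assume i: "i \<in> I" and c: "coprime k (8 * m)"
    show "\<bar>\<psi> i k\<bar> = 1"
    proof (cases "i = 8")
      case True
      then show ?thesis using \<eta>_abs by (simp add: \<psi>_def)
    next
      case False
      then have l: "i \<in> L" using i I8 by blast
      then have "coprime k i" using c l_dvd_m by (meson coprime_divisors dvd_mult dvd_refl)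
      then have "\<not> i dvd k" using L(3)[OF l] by (auto simp: coprime_def dest!: spec[of _ i])
      then show ?thesis
        using Legendre_range[of "int k" "int i"] Legendre_eq_0_iff[of "int k" "int i"] \<psi>L[OF l] by auto
    qed
  next
    fix T assume T: "T \<subseteq> I" "T \<noteq> {}"
    then obtain i where i: "i \<in> T" by blast
    have "\<exists>x. \<psi> i x = -1 \<and> coprime x i"
    proof (cases "i = 8")
      case True
      then have "n mod 8 \<noteq> 3" using i T I_def L8 by auto
      moreover have "coprime w (2^3)" by (subst coprime_power_right_iff) (simp add: w_def)
      then have "coprime w 8" by simp
      ultimately show ?thesis using True \<eta>_w by (auto simp: \<psi>_def)
    next
      case False
      then have l: "i \<in> L" using i T I8 by blast
      then obtain x :: nat where x: "Legendre x i = -1" using exists_nonresidue L by blast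
      then have "\<not> i dvd x" using Legendre_eq_0_iff[of "int x" "int i"] by auto
      then have "coprime x i" using L(1)[OF l] prime_imp_coprime coprime_commute by blast
      then show ?thesis using x \<psi>L[OF l] by auto
    qed
    then obtain x where x: "\<psi> i x = -1" "coprime x i" by blast
    \<comment> \<open>The moduli are pairwise coprime, so some u is x mod i and 1 modulo all others;
      only the factor at i is then -1.\<close>
    have "\<forall>i\<in>insert 8 L. \<forall>j\<in>insert 8 L. i \<noteq> j \<longrightarrow> coprime i j"
      using cop_L8 L(1) by (metis coprime_commute insertE primes_coprime)
    then have "\<exists>u. \<forall>j\<in>insert 8 L. [u = (if j = i then x else 1)] (mod j)"
      using finL by (intro chinese_remainder_nat) auto
    then obtain u where u: "\<And>j. j \<in> insert 8 L \<Longrightarrow> [u = (if j = i then x else 1)] (mod j)"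
      by blast
    have "coprime u j" if "j \<in> insert 8 L" for j
      using cong_imp_coprime[OF cong_sym[OF u[OF that]]] x(2) by (auto split: if_splits)
    then have "coprime u (8 * m)"
      unfolding m_def by (simp add: prod_coprime_right)
    moreover have "(\<Prod>j\<in>T. \<psi> j u) = (\<Prod>j\<in>T. if j = i then -1 else 1)"
    proof (rule prod.cong[OF refl])
      fix j assume "j \<in> T"
      then have "j \<in> insert 8 L" using T I8 by blast
      then show "\<psi> j u = (if j = i then -1 else 1)"
        using \<psi>_cong[OF _ u] x(1) \<psi>_1 by simp
    qed
    then have "(\<Prod>j\<in>T. \<psi> j u) = -1"
      using i T(1) finL by (simp add: I_def finite_subset[OF T(1)])
    ultimately show "\<exists>u. coprime u (8 * m) \<and> (\<Prod>i\<in>T. \<psi> i u) = -1" by blast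
  qed
  have \<delta>: "Legendre (- int \<delta>) l \<in> {-1, 1}" if "l \<in> L" for l
  proof -
    have "\<not> int l dvd int \<delta>"
      using L(3)[OF that] unfolding int_dvd_int_iff by (auto simp: \<delta>_def dest: dvd_imp_le)
    then show ?thesis
      using Legendre_range[of "- int \<delta>" "int l"] Legendre_eq_0_iff[of "- int \<delta>" "int l"] by auto
  qed
  \<comment> \<open>The value at 8 is the product of the other signs, which makes the total product
    a square, namely 1.\<close>
  define \<epsilon> where "\<epsilon> i = (if i = 8 then \<Prod>l\<in>L. Legendre (- int \<delta>) l else Legendre (- int \<delta>) i)" for i :: nat
  have abs_prod_\<delta>: "\<bar>\<Prod>l\<in>L. Legendre (- int \<delta>) l\<bar> = 1"
    unfolding abs_prod using \<delta> by (intro prod.neutral) fastforce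
  have "\<bar>\<epsilon> i\<bar> = 1" if "i \<in> I" for i
  proof (cases "i = 8")
    case True
    then show ?thesis using abs_prod_\<delta> by (simp add: \<epsilon>_def)
  next
    case False
    then have "Legendre (- int \<delta>) i \<in> {-1, 1}" using that I8 \<delta> by blast
    then show ?thesis using False by (auto simp: \<epsilon>_def)
  qed
  moreover have "(\<Prod>i\<in>I. \<epsilon> i) = 1"
  proof -
    have "(\<Prod>l\<in>L. \<epsilon> l) = (\<Prod>l\<in>L. Legendre (- int \<delta>) l)"
      using L8 by (intro prod.cong) (auto simp: \<epsilon>_def)
    moreover have "(\<Prod>l\<in>L. Legendre (- int \<delta>) l) = 1" if "n mod 8 = 3"
    proof -
      have "(\<Prod>l\<in>L. Legendre (- int \<delta>) l) = (\<Prod>l\<in>L. sign4 l * sign8 l)"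
      proof (rule prod.cong[OF refl])
        fix l assume "l \<in> L"
        then show "Legendre (- int \<delta>) l = sign4 l * sign8 l"
          using that L[of l] Legendre_mult[of l "-1" 2]
          by (simp add: \<delta>_def Legendre_minus_1 Legendre_2)
      qed
      also have "\<dots> = sign4 m * sign8 m" by (simp add: prod.distrib m)
      also have "\<dots> = 1"
      proof -
        have "odd n" "n mod 4 = 3" using that by presburger+
        then have "m mod 8 = 3" "m mod 4 = 3" using that m_odd by simp_all
        then show ?thesis by (simp add: sign4_def sign8_def)
      qed
      finally show ?thesis .
    qed
    ultimately show ?thesis
      using abs_prod_\<delta> unfolding prod_I by (auto simp: \<epsilon>_def abs_if split: if_splits)
  qed
  ultimately obtain q where q: "q > 0" "squarefree q" "coprime q (8 * m)" "\<And>i. i \<in> I \<Longrightarrow> \<psi> i q = \<epsilon> i"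
    "\<And>p. prime p \<Longrightarrow> p dvd q \<Longrightarrow> (\<Prod>i\<in>I. \<psi> i p) = 1"
    using exists_prescribed_signs[of \<epsilon>] by blast
  have oddq: "odd q" using q(3) by (auto simp: coprime_def dest!: spec[of _ 2])
  have "n dvd 8 * m"
  proof (cases "even n")
    case True
    then have "8 * m = n * 4" using nm by simp
    then show ?thesis by (rule dvdI)
  qed (use m_odd in simp)
  then have q_n: "coprime q n" using q(3) by (meson coprime_divisors dvd_refl)
  have "\<exists>x. int (\<delta> * q) dvd x^2 + int n"
  proof (rule sqrt_mod_squarefree)
    show "squarefree (\<delta> * q)"
      using q(2) oddq squarefree_mult_coprime[OF _ squarefree_prime[OF two_is_prime_nat] q(2)]
      by (simp add: \<delta>_def)
    show "\<delta> * q > 0" using q(1) by (simp add: \<delta>_def)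
    fix p assume p: "prime p" "p dvd \<delta> * q"
    show "\<exists>x. int p dvd x^2 + int n"
    proof (cases "p = 2")
      case True
      have "even ((int n)^2 + int n)" by simp
      then show ?thesis using True by (metis of_nat_numeral)
    next
      case False
      then have "\<not> p dvd \<delta>" using p(1) primes_dvd_imp_eq[of p 2] by (auto simp: \<delta>_def not_prime_1)
      then have pq: "p dvd q" using p prime_dvd_mult_iff by blast
      have p2: "p > 2" using False prime_ge_2_nat[OF p(1)] by simp
      have "p \<notin> L"
      proof
        assume "p \<in> L"
        then have "p dvd n" by (rule L)
        then show False using pq q_n p(1) by (meson coprime_common_divisor not_prime_unit)
      qed
      then have "Legendre (- int n) p = \<eta> p * (\<Prod>l\<in>L. Legendre p l)"
        using Legendre_n p(1) p2 by blast
      also have "\<dots> = (\<Prod>i\<in>I. \<psi> i p)"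
        unfolding prod_I using \<psi>L \<eta>_trivial[of p] by (simp add: \<psi>_def)
      also have "\<dots> = 1" using q(5) p(1) pq by blast
      finally show ?thesis using Legendre_eq_1_imp by fastforce
    qed
  qed
  then obtain b where b: "int (\<delta> * q) dvd b^2 + int n" by blast
  have "\<exists>x. int n dvd x^2 + int (\<delta> * q)"
  proof (rule sqrt_mod_squarefree)
    fix p assume p: "prime p" "p dvd n"
    show "\<exists>x. int p dvd x^2 + int (\<delta> * q)"
    proof (cases "p = 2")
      case True
      have "even ((int (\<delta> * q))^2 + int (\<delta> * q))" by simp
      then show ?thesis using True by (metis of_nat_numeral)
    next
      case False
      then have l: "p \<in> L" using p even_prime by (auto simp: L_def)
      then have "p \<in> I" "p \<noteq> 8" using L8 by (auto simp: I_def)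
      then have "Legendre q p = Legendre (- int \<delta>) p" using q(4)[of p] by (simp add: \<psi>_def \<epsilon>_def)
      moreover have "Legendre (- int \<delta> * q) p = Legendre (- int \<delta>) p * Legendre q p"
        using Legendre_mult L[OF l] by blast
      ultimately have "Legendre (- int \<delta> * q) p = 1" using \<delta>[OF l] by auto
      then show ?thesis using Legendre_eq_1_imp by fastforce
    qed
  qed (use n n0 in auto)
  then obtain r where r: "int n dvd r^2 + int (\<delta> * q)" by blast
  have "coprime \<delta> n"
  proof (cases "n mod 8 = 3")
    case True
    then have "odd n" by presburger
    then show ?thesis by (simp add: \<delta>_def)
  qed (simp add: \<delta>_def)
  then have "coprime (int (\<delta> * q)) (int n)" using q_n by simp
  moreover have "int (\<delta> * q) > 0" using q(1) by (simp add: \<delta>_def)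
  ultimately show ?thesis using b r by blast
qed

text \<open>Reduction to squarefree n: as 4 does not divide n, a square factor s^2 has s odd, so s^2
  = 1 mod 8 and the quotient keeps the residue class.\<close>

lemma three_squares:
  fixes n :: nat
  assumes "n mod 8 \<in> {1, 2, 3, 5, 6}"
  shows "\<exists>u v w :: int. int n = u^2 + v^2 + w^2"
  using assms
proof (induction n rule: less_induct)
  case (less n)
  have n0: "n > 0" using less.prems by (auto intro: Nat.gr0I)
  show ?case
  proof (cases "squarefree n")
    case True
    then obtain a b r :: int where "a > 0" "coprime a (int n)" "a dvd b^2 + int n" "int n dvd r^2 + a"
      using auxiliary_number less.prems by blast
    then show ?thesis using sum_of_three_squares_from_auxiliary[of "int n" a b r] n0 by simp
  next
    case False
    then obtain s where s: "s^2 dvd n" "\<not> s dvd 1" unfolding squarefree_def by blast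
    then obtain k where k: "n = s^2 * k" by blast
    have "odd s"
    proof
      assume "even s"
      then have "4 dvd n" using k by (auto simp: power2_eq_square)
      then have "4 dvd n mod 8" by (simp add: dvd_mod_iff)
      then show False using less.prems by auto
    qed
    then have "s mod 8 \<in> {1, 3, 5, 7}" by (rule odd_mod_8)
    then have "s^2 mod 8 = 1"
      using power_mod[of s 8 2] by auto
    then have "n mod 8 = k mod 8" unfolding k using mod_mult_left_eq[of "s^2" 8 k] by simp
    moreover have "s > 1" using s n0 k by (cases s) auto
    then have "s^2 > 1" by (rule one_less_power) simp
    then have "k < n" using n0 k by simp
    ultimately obtain u v w :: int where "int k = u^2 + v^2 + w^2" using less by metis
    then have "int n = (int s * u)^2 + (int s * v)^2 + (int s * w)^2"
      using k by (simp add: power_mult_distrib algebra_simps)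
    then show ?thesis by blast
  qed
qed

section \<open>Reflections of vectors of norm 35\<close>

type_synonym quad = "int \<times> int \<times> int \<times> int"

definition rep_135 :: "int \<Rightarrow> int \<Rightarrow> bool" where
  "rep_135 m a \<longleftrightarrow> (\<exists>x y z t. m = x^2 + y^2 + z^2 + t^2 \<and> x + 3 * y + 5 * z = a)"

definition rep_1334 :: "int \<Rightarrow> int \<Rightarrow> quad \<Rightarrow> bool" where
  "rep_1334 m a = (\<lambda>(x, y, z, t). m = x^2 + y^2 + z^2 + t^2 \<and> x + 3 * y + 3 * z + 4 * t = a)"

lemma rep_135I:
  "m = x^2 + y^2 + z^2 + t^2 \<Longrightarrow> x + 3 * y + 5 * z = a \<Longrightarrow> rep_135 m a"
  unfolding rep_135_def by blast

definition dot :: "quad \<Rightarrow> quad \<Rightarrow> int" where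
  "dot = (\<lambda>(a, b, c, d) (x, y, z, t). a * x + b * y + c * z + d * t)"

definition sub_smult :: "quad \<Rightarrow> int \<Rightarrow> quad \<Rightarrow> quad" where
  "sub_smult = (\<lambda>(x, y, z, t) k (a, b, c, d). (x - k * a, y - k * b, z - k * c, t - k * d))"

lemma dot_sub_smult:
  "dot w (sub_smult g k v) = dot w g - k * dot w v"
  "dot (sub_smult w k v) g = dot w g - k * dot v g"
  by (cases w; cases g; cases v; simp add: dot_def sub_smult_def algebra_simps)+

text \<open>
  Normals of reflections that carry \<open>(1, 3, 3, 4)\<close> to a signed permutation of \<open>(1, 3, 5, 0)\<close>; their
  norms are 10 for \<open>mirrors5\<close>, and 7 or 14 for \<open>mirrors7\<close>.
\<close>

definition mirrors5 :: "quad list" where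
  "mirrors5 = [(0, 3, 0, -1), (-1, 2, -1, 2), (0, 0, 3, -1), (1, 2, -2, 1), (2, 1, -1, 2), (2, 2, 1, 1)]"

definition mirrors7 :: "quad list" where
  "mirrors7 = [(1, 2, 1, 1), (3, 1, 0, 2), (1, 1, 2, 1), (3, 0, 1, 2), (-1, -1, 1, 2), (0, 1, 2, 3)]"

text \<open>As w has norm 10, the reflection of g = (x, y, z, t) in w is g - k w, where w . g = 5 k.
  The witnesses are its coordinates, reordered and signed as the image of (1, 3, 3, 4) is relative
  to (1, 3, 5, 0).\<close>

lemma mirrors5_imp_good:
  assumes rep: "rep_1334 m a (x, y, z, t)" and w: "w \<in> set mirrors5" and dvd: "5 dvd dot w (x, y, z, t)"
  shows "rep_135 m a"
proof -
  obtain k where k: "dot w (x, y, z, t) = 5 * k" using dvd by blast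
  have m: "m = x^2 + y^2 + z^2 + t^2" and a: "a = x + 3 * y + 3 * z + 4 * t"
    using rep by (simp_all add: rep_1334_def)
  have "w \<in> {(0, 3, 0, -1), (-1, 2, -1, 2), (0, 0, 3, -1), (1, 2, -2, 1), (2, 1, -1, 2), (2, 2, 1, 1)}"
    using w by (simp add: mirrors5_def)
  then show ?thesis
  proof (elim insertE emptyE)
    assume "w = (0, 3, 0, -1)"
    then have t: "t = 3 * y - 5 * k" using k by (simp add: dot_def)
    show ?thesis unfolding m a
      by (intro rep_135I[of _ "x" "z" "(t + k)" "(y - 3 * k)"]) (simp_all add: t power2_eq_square algebra_simps)
  next
    assume "w = (-1, 2, -1, 2)"
    then have z: "z = - x + 2 * y + 2 * t - 5 * k" using k by (simp add: dot_def)
    show ?thesis unfolding m a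
      by (intro rep_135I[of _ "- (y - 2 * k)" "(x + k)" "(z + k)" "(t - 2 * k)"]) (simp_all add: z power2_eq_square algebra_simps)
  next
    assume "w = (0, 0, 3, -1)"
    then have t: "t = 3 * z - 5 * k" using k by (simp add: dot_def)
    show ?thesis unfolding m a
      by (intro rep_135I[of _ "x" "y" "(t + k)" "(z - 3 * k)"]) (simp_all add: t power2_eq_square algebra_simps)
  next
    assume "w = (1, 2, -2, 1)"
    then have t: "t = - x - 2 * y + 2 * z + 5 * k" using k by (simp add: dot_def)
    show ?thesis unfolding m a
      by (intro rep_135I[of _ "(y - 2 * k)" "(t - k)" "(z + 2 * k)" "(x - k)"]) (simp_all add: t power2_eq_square algebra_simps)
  next
    assume "w = (2, 1, -1, 2)"
    then have z: "z = 2 * x + y + 2 * t - 5 * k" using k by (simp add: dot_def)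
    show ?thesis unfolding m a
      by (intro rep_135I[of _ "(y - k)" "- (x - 2 * k)" "(z + k)" "(t - 2 * k)"]) (simp_all add: z power2_eq_square algebra_simps)
  next
    assume "w = (2, 2, 1, 1)"
    then have t: "t = - 2 * x - 2 * y - z + 5 * k" using k by (simp add: dot_def)
    show ?thesis unfolding m a
      by (intro rep_135I[of _ "(t - k)" "- (y - 2 * k)" "- (x - 2 * k)" "(z - k)"]) (simp_all add: t power2_eq_square algebra_simps)
  qed
qed

text \<open>As for \<open>mirrors5\<close>; with w . g = 7 k the reflection is g - 2 k w for norm 7
  and g - k w for norm 14.\<close>

lemma mirrors7_imp_good:
  assumes rep: "rep_1334 m a (x, y, z, t)" and w: "w \<in> set mirrors7" and dvd: "7 dvd dot w (x, y, z, t)"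
  shows "rep_135 m a"
proof -
  obtain k where k: "dot w (x, y, z, t) = 7 * k" using dvd by blast
  have m: "m = x^2 + y^2 + z^2 + t^2" and a: "a = x + 3 * y + 3 * z + 4 * t"
    using rep by (simp_all add: rep_1334_def)
  have "w \<in> {(1, 2, 1, 1), (3, 1, 0, 2), (1, 1, 2, 1), (3, 0, 1, 2), (-1, -1, 1, 2), (0, 1, 2, 3)}"
    using w by (simp add: mirrors7_def)
  then show ?thesis
  proof (elim insertE emptyE)
    assume "w = (1, 2, 1, 1)"
    then have t: "t = - x - 2 * y - z + 7 * k" using k by (simp add: dot_def)
    show ?thesis unfolding m a
      by (intro rep_135I[of _ "- (z - 2 * k)" "- (x - 2 * k)" "- (y - 4 * k)" "(t - 2 * k)"]) (simp_all add: t power2_eq_square algebra_simps)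
  next
    assume "w = (3, 1, 0, 2)"
    then have y: "y = - 3 * x - 2 * t + 7 * k" using k by (simp add: dot_def)
    show ?thesis unfolding m a
      by (intro rep_135I[of _ "(y - k)" "z" "- (x - 3 * k)" "(t - 2 * k)"]) (simp_all add: y power2_eq_square algebra_simps)
  next
    assume "w = (1, 1, 2, 1)"
    then have t: "t = - x - y - 2 * z + 7 * k" using k by (simp add: dot_def)
    show ?thesis unfolding m a
      by (intro rep_135I[of _ "- (y - 2 * k)" "- (x - 2 * k)" "- (z - 4 * k)" "(t - 2 * k)"]) (simp_all add: t power2_eq_square algebra_simps)
  next
    assume "w = (3, 0, 1, 2)"
    then have z: "z = - 3 * x - 2 * t + 7 * k" using k by (simp add: dot_def)
    show ?thesis unfolding m a
      by (intro rep_135I[of _ "(z - k)" "y" "- (x - 3 * k)" "(t - 2 * k)"]) (simp_all add: z power2_eq_square algebra_simps)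
  next
    assume "w = (-1, -1, 1, 2)"
    then have z: "z = x + y - 2 * t + 7 * k" using k by (simp add: dot_def)
    show ?thesis unfolding m a
      by (intro rep_135I[of _ "(z - 2 * k)" "(x + 2 * k)" "(y + 2 * k)" "(t - 4 * k)"]) (simp_all add: z power2_eq_square algebra_simps)
  next
    assume "w = (0, 1, 2, 3)"
    then have y: "y = - 2 * z - 3 * t + 7 * k" using k by (simp add: dot_def)
    show ?thesis unfolding m a
      by (intro rep_135I[of _ "x" "- (z - 2 * k)" "- (t - 3 * k)" "(y - k)"]) (simp_all add: y power2_eq_square algebra_simps)
  qed
qed

text \<open>
  Each of these four vectors has norm 10 and is orthogonal to \<open>(1, 3, 3, 4)\<close>, and
  \<open>axis1 \<bullet> axis2 = axis3 \<bullet> axis4 = 9\<close>.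
\<close>

definition axis1 :: quad where "axis1 = (-3, 1, 0, 0)"
definition axis2 :: quad where "axis2 = (-3, 0, 1, 0)"
definition axis3 :: quad where "axis3 = (-1, 2, 1, -2)"
definition axis4 :: quad where "axis4 = (-1, 1, 2, -2)"

lemmas axis_defs = axis1_def axis2_def axis3_def axis4_def

text \<open>Since v has norm 10, \<open>sub_smult g k v\<close> is the reflection of g in v, and it
  fixes (1, 3, 3, 4).\<close>

lemma reflect_axis:
  assumes "rep_1334 m a g" "v \<in> {axis1, axis2, axis3, axis4}" "dot v g = 5 * k"
  shows "rep_1334 m a (sub_smult g k v)"
proof -
  obtain x y z t where g: "g = (x, y, z, t)" by (cases g)
  have norm: "(x - k * p)^2 + (y - k * q)^2 + (z - k * r)^2 + (t - k * s)^2
      = x^2 + y^2 + z^2 + t^2 - 2 * k * (p * x + q * y + r * z + s * t) + k^2 * (p^2 + q^2 + r^2 + s^2)" for p q r s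
    by (simp add: power2_eq_square algebra_simps)
  obtain p q r s where v: "v = (p, q, r, s)" by (cases v)
  have pqrs: "p^2 + q^2 + r^2 + s^2 = 10" "p + 3 * q + 3 * r + 4 * s = 0"
    using assms(2) unfolding v axis_defs by auto
  have "p * x + q * y + r * z + s * t = 5 * k"
    using assms(3) by (simp add: v g dot_def)
  then have "(x - k * p)^2 + (y - k * q)^2 + (z - k * r)^2 + (t - k * s)^2 = x^2 + y^2 + z^2 + t^2"
    unfolding norm pqrs by (simp add: power2_eq_square)
  moreover have "(x - k * p) + 3 * (y - k * q) + 3 * (z - k * r) + 4 * (t - k * s)
      = x + 3 * y + 3 * z + 4 * t - k * (p + 3 * q + 3 * r + 4 * s)"
    by (simp add: algebra_simps)
  ultimately show ?thesis
    using assms(1) unfolding g v rep_1334_def sub_smult_def by (simp add: pqrs)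
qed

text \<open>
  Since the divisibility conditions are homogeneous, vectors with scalar product 1 with
  \<open>(1, 3, 3, 4)\<close> suffice.
\<close>

definition covers :: "int \<Rightarrow> quad list list \<Rightarrow> bool" where
  "covers p Cs \<longleftrightarrow> (\<forall>y\<in>set [0..p-1]. \<forall>z\<in>set [0..p-1]. \<forall>t\<in>set [0..p-1].
     \<exists>c\<in>set Cs. \<forall>l\<in>set c. dot l (1 - 3 * y - 3 * z - 4 * t, y, z, t) mod p = 0)"

lemma dot_cong:
  assumes "[x = x'] (mod p)" "[y = y'] (mod p)" "[z = z'] (mod p)" "[t = t'] (mod p)"
  shows "[dot l (x, y, z, t) = dot l (x', y', z', t')] (mod p)"
  using assms by (cases l) (auto simp: dot_def intro!: cong_add cong_mult)

lemma coversD: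
  fixes p :: int
  assumes "covers p Cs" "prime p" "\<not> p dvd dot (1, 3, 3, 4) g"
  shows "\<exists>c\<in>set Cs. \<forall>l\<in>set c. p dvd dot l g"
proof -
  obtain x y z t where g: "g = (x, y, z, t)" by (cases g)
  have "coprime (dot (1, 3, 3, 4) g) p"
    using assms(2,3) prime_imp_coprime coprime_commute by blast
  \<comment> \<open>Scaling by u normalizes the scalar product with (1, 3, 3, 4) to 1 mod p.\<close>
  then obtain u where u: "[dot (1, 3, 3, 4) g * u = 1] (mod p)"
    using cong_solve_coprime_int by blast
  have p: "p > 0" using assms(2) prime_gt_0_int by blast
  have nu: "\<not> p dvd u"
  proof
    assume "p dvd u"
    then have "p dvd 1" using u by (meson cong_dvd_iff dvd_mult)
    then show False using assms(2) not_prime_unit by blast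
  qed
  have "u * y mod p \<in> set [0..p-1]" "u * z mod p \<in> set [0..p-1]" "u * t mod p \<in> set [0..p-1]"
    using p by simp_all
  then obtain c where c: "c \<in> set Cs" and
    l: "\<And>l. l \<in> set c \<Longrightarrow> dot l (1 - 3 * (u * y mod p) - 3 * (u * z mod p) - 4 * (u * t mod p),
      u * y mod p, u * z mod p, u * t mod p) mod p = 0"
    using assms(1) unfolding covers_def by blast
  have "[1 - 3 * (u * y mod p) - 3 * (u * z mod p) - 4 * (u * t mod p)
      = dot (1, 3, 3, 4) g * u - 3 * (u * y) - 3 * (u * z) - 4 * (u * t)] (mod p)"
    by (intro cong_diff cong_sym[OF u] cong_mult) (simp_all add: cong_def)
  also have "dot (1, 3, 3, 4) g * u - 3 * (u * y) - 3 * (u * z) - 4 * (u * t) = u * x"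
    by (simp add: g dot_def algebra_simps)
  finally have x: "[1 - 3 * (u * y mod p) - 3 * (u * z mod p) - 4 * (u * t mod p) = u * x] (mod p)" .
  have "p dvd dot l g" if "l \<in> set c" for l
  proof -
    have "[dot l (1 - 3 * (u * y mod p) - 3 * (u * z mod p) - 4 * (u * t mod p),
      u * y mod p, u * z mod p, u * t mod p) = dot l (u * x, u * y, u * z, u * t)] (mod p)"
      by (intro dot_cong x) (simp_all add: cong_def)
    then have "p dvd dot l (u * x, u * y, u * z, u * t)"
      using l[OF that] by (simp add: cong_def dvd_eq_mod_eq_0)
    also have "dot l (u * x, u * y, u * z, u * t) = u * dot l g"
      by (cases l) (simp add: g dot_def algebra_simps)
    finally show ?thesis using nu assms(2) prime_dvd_mult_iff by blast
  qed
  then show ?thesis using c by blast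
qed

section \<open>Coverings of the residues mod 5 and mod 7\<close>

lemma covers_cases:
  fixes p :: int
  assumes "covers p (map (\<lambda>l. [l]) ws @ cs)" "prime p" "\<not> p dvd dot (1, 3, 3, 4) g"
  obtains l where "l \<in> set ws" "p dvd dot l g" | c where "c \<in> set cs" "\<forall>l\<in>set c. p dvd dot l g"
proof -
  obtain c where "c \<in> set (map (\<lambda>l. [l]) ws @ cs)" "\<forall>l\<in>set c. p dvd dot l g"
    using coversD[OF assms] by blast
  then show thesis using that by (force simp del: split_paired_All split_paired_Ex)
qed

text \<open>If no reflection in \<open>mirrors5\<close> is integral on a vector, then the
  reflections in two of the axes are.\<close>

lemma covers_mod_5:
  "covers 5 (map (\<lambda>l. [l]) mirrors5 @ [[axis1, axis2], [axis3, axis4], [axis1, axis4], [axis2, axis3]])"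
  by code_simp

text \<open>
  For \<open>v\<close> of norm 10, scalar products mod 7 with the reflected vector \<open>g - k v\<close>, where \<open>5 k = v \<bullet> g\<close>, are
  linear in \<open>g\<close> because 3 is inverse to 5.
\<close>

definition reflected_mirrors :: "quad \<Rightarrow> quad list" where
  "reflected_mirrors v = map (\<lambda>w. sub_smult w (3 * dot w v) v) mirrors7"

text \<open>One cover for each pair of axes from the mod 5 check. A reflection in
  \<open>mirrors7\<close>, possibly after one in an axis, is integral at 7, except that the pairs 1,
  2 and 3, 4 leave the case where both scalar products vanish mod 7.\<close>

lemma covers_mod_7:
  "covers 7 (map (\<lambda>l. [l]) (mirrors7 @ reflected_mirrors axis1 @ reflected_mirrors axis2) @ [[axis1, axis2]])"
  "covers 7 (map (\<lambda>l. [l]) (mirrors7 @ reflected_mirrors axis3 @ reflected_mirrors axis4) @ [[axis3, axis4]])"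
  "covers 7 (map (\<lambda>l. [l]) (mirrors7 @ reflected_mirrors axis1 @ reflected_mirrors axis4) @ [])"
  "covers 7 (map (\<lambda>l. [l]) (mirrors7 @ reflected_mirrors axis2 @ reflected_mirrors axis3) @ [])"
  by code_simp+

lemma mirrors_imp_rep_135:
  assumes "rep_1334 m a g" "w \<in> set mirrors5 \<and> 5 dvd dot w g \<or> w \<in> set mirrors7 \<and> 7 dvd dot w g"
  shows "rep_135 m a"
  using assms mirrors5_imp_good mirrors7_imp_good by (cases g) blast

lemma reflected_mirrors_imp_rep_135:
  assumes "rep_1334 m a g" "v \<in> {axis1, axis2, axis3, axis4}" "5 dvd dot v g"
    and "w \<in> set (reflected_mirrors v)" "7 dvd dot w g"
  shows "rep_135 m a"
proof -
  obtain k where k: "dot v g = 5 * k" using assms(3) by blast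
  obtain u where u: "u \<in> set mirrors7" "w = sub_smult u (3 * dot u v) v"
    using assms(4) by (auto simp: reflected_mirrors_def)
  have "dot u (sub_smult g k v) = dot w g + 7 * (2 * k * dot u v)"
    by (simp add: u dot_sub_smult k)
  then have "7 dvd dot u (sub_smult g k v)" using assms(5) by simp
  then show ?thesis using mirrors_imp_rep_135[OF reflect_axis[OF assms(1,2) k]] u(1) by blast
qed

text \<open>The mod 5 cover provides two axes with integral reflections, and the mod 7 cover for
  this pair leaves only its exceptional case; the mixed pairs 1, 4 and 2, 3 have none.\<close>

lemma stuck_cases:
  assumes rep: "rep_1334 m a g" and a: "\<not> 5 dvd a" "\<not> 7 dvd a" and bad: "\<not> rep_135 m a"
  shows "35 dvd dot axis1 g \<and> 35 dvd dot axis2 g \<or> 35 dvd dot axis3 g \<and> 35 dvd dot axis4 g"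
proof -
  have a_eq: "dot (1, 3, 3, 4) g = a" using rep by (cases g) (simp add: dot_def rep_1334_def)
  have no5: "\<not> 5 dvd dot w g" if "w \<in> set mirrors5" for w using mirrors_imp_rep_135 rep bad that by blast
  have no7: "\<not> 7 dvd dot w g" if "w \<in> set mirrors7" for w using mirrors_imp_rep_135 rep bad that by blast
  have no7': "\<not> 7 dvd dot w g"
    if "5 dvd dot v g" "w \<in> set (reflected_mirrors v)" "v \<in> {axis1, axis2, axis3, axis4}" for v w
    using reflected_mirrors_imp_rep_135 rep bad that by blast
  have both: "35 dvd n \<longleftrightarrow> 5 dvd n \<and> 7 dvd n" for n :: int
    by presburger
  have a5: "\<not> 5 dvd dot (1, 3, 3, 4) g" and a7: "\<not> 7 dvd dot (1, 3, 3, 4) g"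
    using a a_eq by simp_all
  have "5 dvd dot axis1 g \<and> 5 dvd dot axis2 g \<or> 5 dvd dot axis3 g \<and> 5 dvd dot axis4 g \<or>
      5 dvd dot axis1 g \<and> 5 dvd dot axis4 g \<or> 5 dvd dot axis2 g \<and> 5 dvd dot axis3 g"
  proof (rule covers_cases[OF covers_mod_5 _ a5])
    fix c assume "c \<in> set [[axis1, axis2], [axis3, axis4], [axis1, axis4], [axis2, axis3]]"
      "\<forall>l\<in>set c. 5 dvd dot l g"
    then show ?thesis
      unfolding list.set insert_iff empty_iff by (elim disjE) simp_all
  qed (use no5 in simp_all)
  then consider "5 dvd dot axis1 g" "5 dvd dot axis2 g" | "5 dvd dot axis3 g" "5 dvd dot axis4 g" |
      "5 dvd dot axis1 g" "5 dvd dot axis4 g" | "5 dvd dot axis2 g" "5 dvd dot axis3 g"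
    by blast
  then show ?thesis
  proof cases
    case 1
    have "7 dvd dot axis1 g \<and> 7 dvd dot axis2 g"
    proof (rule covers_cases[OF covers_mod_7(1) _ a7])
      fix w assume "w \<in> set (mirrors7 @ reflected_mirrors axis1 @ reflected_mirrors axis2)" "7 dvd dot w g"
      then show ?thesis using no7 no7' 1 unfolding set_append by blast
    qed simp_all
    then show ?thesis using 1 both by blast
  next
    case 2
    have "7 dvd dot axis3 g \<and> 7 dvd dot axis4 g"
    proof (rule covers_cases[OF covers_mod_7(2) _ a7])
      fix w assume "w \<in> set (mirrors7 @ reflected_mirrors axis3 @ reflected_mirrors axis4)" "7 dvd dot w g"
      then show ?thesis using no7 no7' 2 unfolding set_append by blast
    qed simp_all
    then show ?thesis using 2 both by blast
  next
    case 3
    show ?thesis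
    proof (rule covers_cases[OF covers_mod_7(3) _ a7])
      fix w assume "w \<in> set (mirrors7 @ reflected_mirrors axis1 @ reflected_mirrors axis4)" "7 dvd dot w g"
      then show ?thesis using no7 no7' 3 unfolding set_append by blast
    qed simp_all
  next
    case 4
    show ?thesis
    proof (rule covers_cases[OF covers_mod_7(4) _ a7])
      fix w assume "w \<in> set (mirrors7 @ reflected_mirrors axis2 @ reflected_mirrors axis3)" "7 dvd dot w g"
      then show ?thesis using no7 no7' 4 unfolding set_append by blast
    qed simp_all
  qed
qed

text \<open>Bootstrapping powers of 5. If 5^n divides the scalar products with v and v' for every
  such vector, apply this to g and to its reflection g - k v: then 5^n divides 9 k and 10 k = 2 (v .
  g), hence k, so 5^(n+1) divides v . g = 5 k. Reflection preserves divisibility by 7 because 7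
  divides k.\<close>

lemma stuck_on_axes:
  fixes v v' :: quad
  assumes axes: "v \<in> {axis1, axis2, axis3, axis4}" "v' \<in> {axis1, axis2, axis3, axis4}"
    "dot v v = 10" "dot v' v' = 10" "dot v v' = 9" "dot v' v = 9"
    and stuck: "\<And>g. rep_1334 m a g \<Longrightarrow> 7 dvd dot v g \<Longrightarrow> 7 dvd dot v' g \<Longrightarrow> 5 dvd dot v g \<and> 5 dvd dot v' g"
    and g: "rep_1334 m a g" "7 dvd dot v g" "7 dvd dot v' g"
  shows "dot v g = 0 \<and> dot v' g = 0"
proof -
  have "5 ^ n dvd dot v g \<and> 5 ^ n dvd dot v' g" for n
    using g
  proof (induction n arbitrary: g)
    case (Suc n)
    obtain k k' where k: "dot v g = 5 * k" "dot v' g = 5 * k'" using stuck[OF Suc.prems] by blast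
    have 7: "7 dvd k" "7 dvd k'" using Suc.prems(2,3) k by (auto simp: prime_dvd_mult_iff)
    have "5 ^ n dvd dot v' g - k * 9"
      using Suc.IH[of "sub_smult g k v"] reflect_axis[OF Suc.prems(1) axes(1) k(1)] Suc.prems(2,3) 7 axes
      by (simp add: dot_sub_smult)
    moreover have "5 ^ n dvd dot v g - k' * 9"
      using Suc.IH[of "sub_smult g k' v'"] reflect_axis[OF Suc.prems(1) axes(2) k(2)] Suc.prems(2,3) 7 axes
      by (simp add: dot_sub_smult)
    moreover have "5 ^ n dvd dot v g" "5 ^ n dvd dot v' g" using Suc.IH[OF Suc.prems] by blast+
    ultimately have "5 ^ n dvd k * 9" "5 ^ n dvd k' * 9"
      by (metis dvd_diff_right_iff dvd_diff_left_iff)+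
    moreover have "5 ^ n dvd k * 10" "5 ^ n dvd k' * 10"
      using dvd_mult2[of "5 ^ n" "dot v g" 2] dvd_mult2[of "5 ^ n" "dot v' g" 2] Suc.IH[OF Suc.prems] k
      by (simp_all add: mult.commute)
    ultimately have "5 ^ n dvd k * 10 - k * 9" "5 ^ n dvd k' * 10 - k' * 9" using dvd_diff by blast+
    then show ?case by (simp add: k)
  qed simp
  moreover have "x = 0" if "\<And>n. 5 ^ n dvd x" for x :: int
  proof (rule ccontr)
    assume "x \<noteq> 0"
    then have "finite {n. 5 ^ n dvd x}" by (rule finite_divisor_powers) simp
    then show False using that by simp
  qed
  ultimately show ?thesis by blast
qed

text \<open>All four axes cannot have scalar product 0 mod 7 with the same vector, so a stuck vector
  stays stuck on the same pair of axes under their reflections. It is therefore orthogonal to both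
  axes and lies in a plane.\<close>

lemma rep_1334_imp_rep_135:
  assumes rep: "rep_1334 m a g" and a: "\<not> 5 dvd a" "\<not> 7 dvd a" and bad: "\<not> rep_135 m a"
  shows "19 dvd 35 * m - a^2"
proof -
  note cases = stuck_cases[OF _ a bad]
  have 7: "\<not> (7 dvd dot axis1 h \<and> 7 dvd dot axis2 h \<and> 7 dvd dot axis3 h \<and> 7 dvd dot axis4 h)"
    if "rep_1334 m a h" for h
  proof
    assume *: "7 dvd dot axis1 h \<and> 7 dvd dot axis2 h \<and> 7 dvd dot axis3 h \<and> 7 dvd dot axis4 h"
    obtain x y z t where h: "h = (x, y, z, t)" by (cases h)
    have d: "7 dvd - 3 * x + y" "7 dvd - 3 * x + z" "7 dvd - x + 2 * y + z - 2 * t"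
      using * by (auto simp: h dot_def axis_defs)
    \<comment> \<open>Mod 7, (1, 3, 3, 4) is a combination of \<open>axis2\<close> and
      \<open>axis3\<close>.\<close>
    have "a = 7 * (2 * x + y) + 5 * (- 3 * x + z) - 2 * (- x + 2 * y + z - 2 * t)"
      using that by (simp add: h rep_1334_def)
    then have "7 dvd a" using d by (simp only: dvd_add dvd_diff dvd_mult dvd_triv_left)
    then show False using a by blast
  qed
  have 35: "(5::int) dvd n \<and> 7 dvd n" if "35 dvd n" for n :: int
    using that by (auto intro: dvd_trans)
  obtain x y z t where g: "g = (x, y, z, t)" by (cases g)
  have m: "m = x^2 + y^2 + z^2 + t^2" and a_eq: "a = x + 3 * y + 3 * z + 4 * t"
    using rep by (simp_all add: g rep_1334_def)
  from cases[OF rep] show ?thesis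
  proof
    assume *: "35 dvd dot axis1 g \<and> 35 dvd dot axis2 g"
    have "dot axis1 g = 0 \<and> dot axis2 g = 0"
    proof (rule stuck_on_axes[where m = m and a = a])
      show "5 dvd dot axis1 h \<and> 5 dvd dot axis2 h"
        if "rep_1334 m a h" "7 dvd dot axis1 h" "7 dvd dot axis2 h" for h
        using cases[OF that(1)] 7[OF that(1)] that 35 by blast
    qed (use rep * 35 in \<open>auto simp: axis_defs dot_def\<close>)
    then have "y = 3 * x" "z = 3 * x" by (simp_all add: g dot_def axis_defs)
    \<comment> \<open>The left side is the Gram determinant of g and (1, 3, 3, 4). Both lie in the
      lattice spanned by (1, 3, 3, 0) and (0, 0, 0, 1), whose Gram determinant is 19. In the other
      case the basis (3, 1, 1, 0), (-2, 0, 0, 1) also has Gram determinant 19.\<close>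
    then have "35 * m - a^2 = 19 * (4 * x - t)^2"
      by (simp add: m a_eq power2_eq_square algebra_simps)
    then show ?thesis by simp
  next
    assume *: "35 dvd dot axis3 g \<and> 35 dvd dot axis4 g"
    have "dot axis3 g = 0 \<and> dot axis4 g = 0"
    proof (rule stuck_on_axes[where m = m and a = a])
      show "5 dvd dot axis3 h \<and> 5 dvd dot axis4 h"
        if "rep_1334 m a h" "7 dvd dot axis3 h" "7 dvd dot axis4 h" for h
        using cases[OF that(1)] 7[OF that(1)] that 35 by blast
    qed (use rep * 35 in \<open>auto simp: axis_defs dot_def\<close>)
    then have z: "z = y" and x: "x = 3 * y - 2 * t" by (simp_all add: g dot_def axis_defs)
    have "35 * m - a^2 = 19 * (4 * y - 3 * t)^2"
      by (simp add: m a_eq z x power2_eq_square algebra_simps)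
    then show ?thesis by simp
  qed
qed

section \<open>Division of quaternions and the theorem\<close>

lemma square_mod_5: "(n::int)^2 mod 5 \<in> {0, 1, 4}"
proof -
  have "n mod 5 = 0 \<or> n mod 5 = 1 \<or> n mod 5 = 2 \<or> n mod 5 = 3 \<or> n mod 5 = 4" by presburger
  then have "(n mod 5)^2 mod 5 \<in> {0, 1, 4}" by (elim disjE) simp_all
  then show ?thesis by (simp add: power_mod)
qed

lemma dvd_5_sum_squares:
  assumes "5 dvd (u::int)^2 + v^2"
  obtains v' where "v'^2 = v^2" "5 dvd u + 2 * v'"
proof -
  have "(u + 2 * v) * (u + 2 * (- v)) = (u^2 + v^2) - 5 * v^2"
    by (simp add: power2_eq_square algebra_simps)
  then have "5 dvd (u + 2 * v) * (u + 2 * (- v))" using assms by (simp only: dvd_diff dvd_triv_left)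
  then have "5 dvd u + 2 * v \<or> 5 dvd u + 2 * (- v)"
    using prime_dvd_mult_iff[of 5 "u + 2 * v" "u + 2 * (- v)"] by simp
  then show thesis using that[of v] that[of "- v"] by auto
qed

text \<open>Squares are 0, 1 or -1 mod 5, so four of them with sum 0 mod 5 split into two pairs with
  sum 0; in each pair a sign can be chosen because -1 = 2^2 mod 5.\<close>

lemma divide_by_norm_5:
  fixes a b c d :: int
  assumes "5 dvd a^2 + b^2 + c^2 + d^2"
  shows "\<exists>b' c' d'. b'^2 + c'^2 + d'^2 = b^2 + c^2 + d^2 \<and> 5 dvd a + 2 * b' \<and> 5 dvd c' + 2 * d'"
proof -
  have pair: "\<exists>b' c' d'. b'^2 + c'^2 + d'^2 = p^2 + q^2 + r^2 \<and> 5 dvd a + 2 * b' \<and> 5 dvd c' + 2 * d'"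
    if "5 dvd a^2 + p^2" "5 dvd q^2 + r^2" for p q r
    using dvd_5_sum_squares[OF that(1)] dvd_5_sum_squares[OF that(2)] by metis
  have split: "5 dvd a^2 + p^2 \<Longrightarrow> 5 dvd q^2 + r^2" if "a^2 + p^2 + (q^2 + r^2) = a^2 + b^2 + c^2 + d^2" for p q r
    using assms that by (metis dvd_add_right_iff)
  have key: "5 dvd A + B \<or> 5 dvd A + C \<or> 5 dvd A + D"
    if "A mod 5 \<in> {0, 1, 4}" "B mod 5 \<in> {0, 1, 4}" "C mod 5 \<in> {0, 1, 4}" "D mod 5 \<in> {0, 1, 4}"
      "5 dvd A + B + C + D" for A B C D :: int
  proof -
    have "(A mod 5 + B mod 5) mod 5 = 0 \<or> (A mod 5 + C mod 5) mod 5 = 0 \<or> (A mod 5 + D mod 5) mod 5 = 0"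
      if "(A mod 5 + B mod 5 + C mod 5 + D mod 5) mod 5 = 0"
      using \<open>A mod 5 \<in> _\<close> \<open>B mod 5 \<in> _\<close> \<open>C mod 5 \<in> _\<close> \<open>D mod 5 \<in> _\<close> that
      unfolding insert_iff empty_iff by (elim disjE FalseE) (simp_all only:, simp_all)
    moreover have "[A mod 5 + B mod 5 + C mod 5 + D mod 5 = A + B + C + D] (mod 5)"
      by (intro cong_add) (simp_all add: cong_def)
    ultimately show ?thesis using that(5) unfolding cong_def mod_add_eq dvd_eq_mod_eq_0
      by (simp only: simp_thms)
  qed
  have "5 dvd a^2 + b^2 \<or> 5 dvd a^2 + c^2 \<or> 5 dvd a^2 + d^2"
    by (rule key[OF square_mod_5 square_mod_5 square_mod_5 square_mod_5 assms])
  then show ?thesis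
  proof (elim disjE)
    assume *: "5 dvd a^2 + b^2"
    have "5 dvd c^2 + d^2" by (rule split[OF _ *]) simp
    from pair[OF * this] show ?thesis by (simp add: algebra_simps)
  next
    assume *: "5 dvd a^2 + c^2"
    have "5 dvd b^2 + d^2" by (rule split[OF _ *]) simp
    from pair[OF * this] show ?thesis by (simp add: algebra_simps)
  next
    assume *: "5 dvd a^2 + d^2"
    have "5 dvd b^2 + c^2" by (rule split[OF _ *]) simp
    from pair[OF * this] show ?thesis by (simp add: algebra_simps)
  qed
qed

text \<open>The matrix of left multiplication by 2 - s i - u j - v k; a quaternion has the left
  divisor 2 + s i + u j + v k of norm 7 iff 7 divides all four resulting coordinates.\<close>

definition conjugate_rows :: "int \<Rightarrow> int \<Rightarrow> int \<Rightarrow> quad list" where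
  "conjugate_rows s u v = [(2, s, u, v), (-s, 2, v, -u), (-u, -v, 2, s), (-v, u, -s, 2)]"

text \<open>
  By homogeneity it suffices to look at residues with \<open>(a, b) = (0, 1)\<close> or \<open>a = 1\<close>, since a sum of two
  squares is divisible by 7 only if both of them are.
\<close>

lemma divide_by_norm_7_residues:
  "\<forall>(a, b)\<in>set ((0, 1) # map (Pair 1) [0..6]). \<forall>c\<in>set [0..6].
     \<forall>d\<in>set (filter (\<lambda>d. (a * a + b * b + c * c + d * d) mod 7 = 0) [0..6]).
     \<exists>s\<in>set [1, -1]. \<exists>u\<in>set [1, -1]. \<exists>v\<in>set [1, -1].
       \<forall>l\<in>set (conjugate_rows s u v). dot l (a, b, c, d) mod 7 = 0"
  by code_simp

lemma square_mod_7: "(n::int)^2 mod 7 \<in> {0, 1, 2, 4}" and square_mod_7_eq_0: "(n::int)^2 mod 7 = 0 \<longleftrightarrow> 7 dvd n"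
proof -
  have "n mod 7 = 0 \<or> n mod 7 = 1 \<or> n mod 7 = 2 \<or> n mod 7 = 3 \<or> n mod 7 = 4 \<or> n mod 7 = 5 \<or> n mod 7 = 6"
    by presburger
  then have *: "(n mod 7)^2 mod 7 \<in> {0, 1, 2, 4} \<and> ((n mod 7)^2 mod 7 = 0 \<longleftrightarrow> n mod 7 = 0)"
    by (elim disjE) simp_all
  show "n^2 mod 7 \<in> {0, 1, 2, 4}"
    using conjunct1[OF *] unfolding power_mod .
  show "n^2 mod 7 = 0 \<longleftrightarrow> 7 dvd n"
    using conjunct2[OF *] unfolding power_mod dvd_eq_mod_eq_0 .
qed

lemma seven_dvd_sum_two_squares:
  assumes "7 dvd (c::int)^2 + d^2" shows "7 dvd c \<and> 7 dvd d"
proof -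
  have "(c^2 mod 7 + d^2 mod 7) mod 7 = 0"
    unfolding mod_add_eq using assms by (simp only: dvd_eq_mod_eq_0)
  then have "c^2 mod 7 = 0 \<and> d^2 mod 7 = 0"
    using square_mod_7[of c] square_mod_7[of d] unfolding insert_iff empty_iff
    by (elim disjE FalseE) (simp_all only:, simp_all)
  then show ?thesis unfolding square_mod_7_eq_0 .
qed

lemma divide_by_norm_7:
  fixes a b c d :: int
  assumes norm: "7 dvd a^2 + b^2 + c^2 + d^2"
  obtains s u v where "s \<in> {1, -1}" "u \<in> {1, -1}" "v \<in> {1, -1 :: int}"
    "\<And>l. l \<in> set (conjugate_rows s u v) \<Longrightarrow> 7 dvd dot l (a, b, c, d)"
proof (cases "7 dvd a \<and> 7 dvd b")
  case True
  then have "7 dvd a^2 + b^2" by (simp add: power2_eq_square)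
  moreover have "a^2 + b^2 + c^2 + d^2 = (a^2 + b^2) + (c^2 + d^2)" by simp
  ultimately have "7 dvd c^2 + d^2" using norm by (metis dvd_add_right_iff)
  then have cd: "7 dvd c \<and> 7 dvd d" by (rule seven_dvd_sum_two_squares)
  have "7 dvd dot l (a, b, c, d)" for l
    using True cd by (cases l) (simp add: dot_def)
  then show thesis using that[of 1 1 1] by simp
next
  case False
  have inv: "\<exists>w. [w * n = 1] (mod 7) \<and> \<not> 7 dvd w" if n: "\<not> 7 dvd n" for n :: int
  proof -
    have "coprime n 7" using n prime_imp_coprime[of 7 n] by (simp add: coprime_commute)
    then obtain w where w: "[n * w = 1] (mod 7)" using cong_solve_coprime_int by blast
    have "\<not> 7 dvd w"
    proof
      assume "7 dvd w"
      then have "7 dvd (1 :: int)" using w by (meson cong_dvd_iff dvd_mult)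
      then show False by simp
    qed
    then show ?thesis using w by (auto simp: mult.commute)
  qed
  obtain w e f where w: "\<not> 7 dvd w" and ef: "(e, f) \<in> set ((0, 1) # map (Pair 1) [0..6])"
    and we: "[w * a = e] (mod 7)" and wf: "[w * b = f] (mod 7)"
  proof (cases "7 dvd a")
    case True
    then obtain w where "[w * b = 1] (mod 7)" "\<not> 7 dvd w" using inv[of b] False by blast
    moreover have "[w * a = 0] (mod 7)" using True by (simp add: cong_0_iff)
    ultimately show thesis using that[of w 0 1] by simp
  next
    case False
    then obtain w where "[w * a = 1] (mod 7)" "\<not> 7 dvd w" using inv by blast
    moreover have "[w * b = w * b mod 7] (mod 7)" by (simp add: cong_def)
    ultimately show thesis using that[of w 1 "w * b mod 7"] by simp
  qed
  define g h where "g = w * c mod 7" and "h = w * d mod 7"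
  have gh: "[w * c = g] (mod 7)" "[w * d = h] (mod 7)" by (simp_all add: g_def h_def cong_def)
  have "[w * a * (w * a) + w * b * (w * b) + w * c * (w * c) + w * d * (w * d) = e * e + f * f + g * g + h * h] (mod 7)"
    by (intro cong_add cong_mult we wf gh)
  moreover have "w * a * (w * a) + w * b * (w * b) + w * c * (w * c) + w * d * (w * d)
      = w^2 * (a^2 + b^2 + c^2 + d^2)"
    by (simp add: power2_eq_square algebra_simps)
  then have "7 dvd w * a * (w * a) + w * b * (w * b) + w * c * (w * c) + w * d * (w * d)"
    using norm by (simp only: dvd_mult)
  ultimately have "(e * e + f * f + g * g + h * h) mod 7 = 0"
    by (simp only: cong_def dvd_eq_mod_eq_0)
  moreover have "g \<in> set [0..6]" "h \<in> set [0..6]" by (simp_all add: g_def h_def)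
  ultimately have "h \<in> set (filter (\<lambda>d. (e * e + f * f + g * g + d * d) mod 7 = 0) [0..6])" "g \<in> set [0..6]"
    by (simp_all only: set_filter mem_Collect_eq)
  then obtain s u v where suv: "s \<in> set [1, -1]" "u \<in> set [1, -1]" "v \<in> set [1, -1]"
    and l: "\<forall>l\<in>set (conjugate_rows s u v). dot l (e, f, g, h) mod 7 = 0"
    using bspec[OF divide_by_norm_7_residues ef] unfolding prod.case by blast
  have "7 dvd dot l (a, b, c, d)" if "l \<in> set (conjugate_rows s u v)" for l
  proof -
    have "[dot l (w * a, w * b, w * c, w * d) = dot l (e, f, g, h)] (mod 7)"
      by (intro dot_cong we wf gh)
    then have "7 dvd dot l (w * a, w * b, w * c, w * d)"
      using l that by (simp add: cong_def dvd_eq_mod_eq_0)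
    moreover have "dot l (w * a, w * b, w * c, w * d) = w * dot l (a, b, c, d)"
      by (cases l) (simp add: dot_def algebra_simps)
    ultimately show ?thesis using w prime_dvd_mult_iff[of 7 w] by simp
  qed
  then show thesis using that suv by simp
qed

text \<open>
  After a signed permutation of \<open>b, c, d\<close>, the quaternion \<open>a + bi + cj + dk\<close> is divisible from the left by
  \<open>1 + 2i\<close>, and the quotient \<open>A + Bi + Cj + Dk\<close> by some \<open>2 \<plusminus> i \<plusminus> j \<plusminus> k\<close>. The product of the two divisors has
  the coordinates \<open>0, 1, 3, 5\<close> or \<open>1, 3, 3, 4\<close> up to order and sign.
\<close>

lemma sum_of_four_squares_lift:
  fixes a b c d m :: int
  assumes "a^2 + b^2 + c^2 + d^2 = 35 * m"
  shows "rep_135 m a \<or> (\<exists>g. rep_1334 m a g)"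
proof -
  have "5 dvd a^2 + b^2 + c^2 + d^2" using assms by simp
  then obtain b' c' d' where b': "b'^2 + c'^2 + d'^2 = b^2 + c^2 + d^2" "5 dvd a + 2 * b'" "5 dvd c' + 2 * d'"
    using divide_by_norm_5 by blast
  define A where "A = (a + 2 * b') div 5"
  define B where "B = b' - 2 * A"
  define C where "C = (c' + 2 * d') div 5"
  define D where "D = d' - 2 * C"
  have 5: "a = A - 2 * B" "b' = B + 2 * A" "c' = C - 2 * D" "d' = D + 2 * C"
    using b'(2,3) unfolding A_def B_def C_def D_def by auto
  have "5 * (A^2 + B^2 + C^2 + D^2) = 35 * m"
    using assms b'(1) unfolding 5 by (simp add: power2_eq_square algebra_simps)
  then have norm: "A^2 + B^2 + C^2 + D^2 = 7 * m" by simp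
  then have "7 dvd A^2 + B^2 + C^2 + D^2" by simp
  then obtain s u v where suv: "s \<in> {1, -1}" "u \<in> {1, -1}" "v \<in> {1, -1 :: int}"
    and rows: "\<And>l. l \<in> set (conjugate_rows s u v) \<Longrightarrow> 7 dvd dot l (A, B, C, D)"
    by (rule divide_by_norm_7) blast
  have "7 dvd 2 * A + s * B + u * C + v * D"
    using rows[of "(2, s, u, v)"] by (simp add: conjugate_rows_def dot_def algebra_simps)
  then obtain x where x: "2 * A + s * B + u * C + v * D = 7 * x" by (rule dvdE)
  have "7 dvd - s * A + 2 * B + v * C - u * D"
    using rows[of "(-s, 2, v, -u)"] by (simp add: conjugate_rows_def dot_def algebra_simps)
  then obtain y where y: "- s * A + 2 * B + v * C - u * D = 7 * y" by (rule dvdE)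
  have "7 dvd - u * A - v * B + 2 * C + s * D"
    using rows[of "(-u, -v, 2, s)"] by (simp add: conjugate_rows_def dot_def algebra_simps)
  then obtain z where z: "- u * A - v * B + 2 * C + s * D = 7 * z" by (rule dvdE)
  have "7 dvd - v * A + u * B - s * C + 2 * D"
    using rows[of "(-v, u, -s, 2)"] by (simp add: conjugate_rows_def dot_def algebra_simps)
  then obtain t where t: "- v * A + u * B - s * C + 2 * D = 7 * t" by (rule dvdE)
  have A: "A = 2 * x - s * y - u * z - v * t" and B: "B = 2 * y + s * x + u * t - v * z"
    and C: "C = 2 * z + u * x + v * y - s * t" and D: "D = 2 * t + v * x + s * z - u * y"
    using x y z t suv by auto
  have "7 * (x^2 + y^2 + z^2 + t^2) = 7 * m"
    unfolding norm[symmetric] A B C D using suv by (auto simp: power2_eq_square algebra_simps)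
  then have m: "m = x^2 + y^2 + z^2 + t^2" by simp
  have a: "a = (2 - 2 * s) * x - (s + 4) * y + (2 * v - u) * z - (v + 2 * u) * t"
    unfolding 5 A B by (simp add: algebra_simps)
  \<comment> \<open>The coefficients of z and t are \<plusminus>1 and \<plusminus>3 in some order.
    Those of x and y are, up to sign, 0 and 5 for s = 1 and 4 and 3 for s = -1.\<close>
  obtain p q where pq: "p^2 + q^2 = z^2 + t^2" "(2 * v - u) * z - (v + 2 * u) * t = p + 3 * q"
  proof -
    consider "u = 1" "v = 1" | "u = 1" "v = -1" | "u = -1" "v = 1" | "u = -1" "v = -1" using suv by blast
    then show thesis
    proof cases
      case 1 then show thesis using that[of z "- t"] by simp
    next
      case 2 then show thesis using that[of "- t" "- z"] by simp
    next
      case 3 then show thesis using that[of t z] by simp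
    next
      case 4 then show thesis using that[of "- z" t] by simp
    qed
  qed
  from suv(1) have "s = 1 \<or> s = -1" by simp
  then show ?thesis
  proof
    assume "s = 1"
    then have "rep_135 m a"
      using m a pq by (intro rep_135I[of _ p q "- y" x]) simp_all
    then show ?thesis ..
  next
    assume "s = -1"
    then have "rep_1334 m a (p, q, - y, x)"
      using m a pq by (simp add: rep_1334_def)
    then show ?thesis by blast
  qed
qed

section \<open>Choice of the square by the residue of m\<close>

lemma rep_135_or_19_dvd:
  fixes m a :: int and n :: nat
  assumes "35 * m - a^2 = int n" "n mod 8 \<in> {1, 2, 3, 5, 6} \<or> (\<exists>k. n = 4 * k \<and> k mod 8 \<in> {2, 6})"
    and "\<not> 5 dvd a" "\<not> 7 dvd a"
  shows "rep_135 m a \<or> 19 dvd 35 * m - a^2"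
proof -
  have "\<exists>u v w :: int. int n = u^2 + v^2 + w^2"
  proof (cases "n mod 8 \<in> {1, 2, 3, 5, 6}")
    case False
    then obtain k where k: "n = 4 * k" "k mod 8 \<in> {2, 6}" using assms(2) by blast
    then obtain u v w :: int where "int k = u^2 + v^2 + w^2" using three_squares[of k] by auto
    then have "int n = (2 * u)^2 + (2 * v)^2 + (2 * w)^2" using k by (simp add: power_mult_distrib)
    then show ?thesis by blast
  qed (rule three_squares)
  then obtain u v w :: int where "a^2 + u^2 + v^2 + w^2 = 35 * m" using assms(1) by (auto simp: algebra_simps)
  then show ?thesis using sum_of_four_squares_lift rep_1334_imp_rep_135 assms(3,4) by blast
qed

text \<open>For m mod 8 in {1, 2, 4, 5, 6} odd a keep 35 m - a^2 off the residues 0, 4, 7 mod 8, so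
  1 and 9 are tried. Otherwise 4 and 36 are tried, with a factor 4 removed if m = 8 mod 16. If both
  members of a pair failed, 19 would divide 80 or 1280.\<close>

lemma rep_135_small_squares:
  fixes m :: nat
  assumes "\<not> 16 dvd m"
  shows "\<exists>a\<in>{1, 4, 9, 36}. rep_135 (int m) a"
proof (rule ccontr)
  assume "\<not> ?thesis"
  then have no: "\<not> rep_135 (int m) 1" "\<not> rep_135 (int m) 4" "\<not> rep_135 (int m) 9" "\<not> rep_135 (int m) 36"
    by auto
  have "m mod 8 \<in> {1, 2, 4, 5, 6} \<or> m mod 8 \<in> {3, 7} \<or> m mod 16 = 8"
  proof -
    have "m mod 8 < 8" by simp
    then have "m mod 8 = 0 \<or> m mod 8 = 1 \<or> m mod 8 = 2 \<or> m mod 8 = 3 \<or> m mod 8 = 4 \<or> m mod 8 = 5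
      \<or> m mod 8 = 6 \<or> m mod 8 = 7" by linarith
    moreover have "m mod 16 = 8" if "m mod 8 = 0" using that assms by presburger
    ultimately show ?thesis by auto
  qed
  then show False
  proof (elim disjE)
    assume m: "m mod 8 \<in> {1, 2, 4, 5, 6}"
    define j where "j = m div 8"
    have m_eq: "m = 8 * j + m mod 8" by (simp add: j_def)
    have "m \<ge> 1" using m by (auto intro: Suc_leI Nat.gr0I)
    have "(35 * m - 1) mod 8 \<in> {1, 2, 3, 5, 6}"
    proof -
      have "35 * m - 1 = 8 * (35 * j) + (35 * (m mod 8) - 1)" using m m_eq by auto
      then have "(35 * m - 1) mod 8 = (35 * (m mod 8) - 1) mod 8" by (simp only: mod_mult_self4)
      then show ?thesis using m by auto
    qed
    then have "19 dvd 35 * int m - 1"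
      using rep_135_or_19_dvd[of "int m" 1 "35 * m - 1"] no \<open>m \<ge> 1\<close> by (simp add: of_nat_diff)
    \<comment> \<open>These are the positive m with 35 m < 81; neither 34 nor 69 is a multiple of
      19.\<close>
    then have "m \<noteq> 1" "m \<noteq> 2" by auto
    then have "m \<ge> 3" using \<open>m \<ge> 1\<close> by simp
    have "(35 * m - 81) mod 8 \<in> {1, 2, 3, 5, 6}"
    proof -
      have "35 * m - 1 = 8 * 10 + (35 * m - 81)" using \<open>m \<ge> 3\<close> by simp
      then have "(35 * m - 1) mod 8 = (35 * m - 81) mod 8" by (simp only: mod_mult_self4)
      then show ?thesis using \<open>(35 * m - 1) mod 8 \<in> {1, 2, 3, 5, 6}\<close> by simp
    qed
    then have "19 dvd 35 * int m - 81"
      using rep_135_or_19_dvd[of "int m" 9 "35 * m - 81"] no \<open>m \<ge> 3\<close> by (simp add: of_nat_diff)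
    then have "19 dvd (35 * int m - 1) - (35 * int m - 81)"
      using \<open>19 dvd 35 * int m - 1\<close> by (rule dvd_diff[rotated])
    then show False by simp
  next
    \<comment> \<open>Divisibility of 35 m - 16 by 19 means m = 1 mod 19. The exclusion of 1 and 20
      gives m \<ge> 38, just enough for 35 m \<ge> 36^2.\<close>
    have finish: False
      if "35 * m \<ge> 16" "m \<noteq> 1" "m \<noteq> 20"
        "(35 * m - 16) mod 8 \<in> {1, 2, 3, 5, 6} \<or> (\<exists>k. 35 * m - 16 = 4 * k \<and> k mod 8 \<in> {2, 6})"
        "35 * m \<ge> 1296 \<Longrightarrow> (35 * m - 1296) mod 8 \<in> {1, 2, 3, 5, 6} \<or> (\<exists>k. 35 * m - 1296 = 4 * k \<and> k mod 8 \<in> {2, 6})"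
    proof -
      have 19: "19 dvd 35 * int m - 16"
        using rep_135_or_19_dvd[of "int m" 4 "35 * m - 16"] no that(1,4) by (simp add: of_nat_diff)
      have "m \<ge> 38"
      proof (rule ccontr)
        assume "\<not> m \<ge> 38"
        moreover have "m mod 19 = 1" using 19 by presburger
        ultimately have "m = 1 \<or> m = 20" by presburger
        then show False using that(2,3) by blast
      qed
      then have "19 dvd 35 * int m - 1296"
        using rep_135_or_19_dvd[of "int m" 36 "35 * m - 1296"] no that(5) by (simp add: of_nat_diff)
      then have "19 dvd (35 * int m - 16) - (35 * int m - 1296)"
        using 19 by (rule dvd_diff[rotated])
      then show False by simp
    qed
    {
      assume m: "m mod 8 \<in> {3, 7}"
      define j where "j = m div 8"
      have m_eq: "m = 8 * j + m mod 8" by (simp add: j_def)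
      have mod: "(35 * m) mod 8 \<in> {1, 5}"
      proof -
        have "35 * m mod 8 = 35 * (m mod 8) mod 8" by (rule mod_mult_right_eq[symmetric])
        also have "\<dots> \<in> {1, 5}" using m by (elim insertE emptyE) simp_all
        finally show ?thesis .
      qed
      \<comment> \<open>Applied with 8 * 2 = 4^2 and 8 * 162 = 36^2.\<close>
      have shift: "(35 * m - 8 * k) mod 8 \<in> {1, 5}" if "35 * m \<ge> 8 * k" for k
      proof -
        have "35 * m = 8 * k + (35 * m - 8 * k)" using that by simp
        then have "(35 * m) mod 8 = (35 * m - 8 * k) mod 8" by (metis mod_mult_self4)
        then show ?thesis using mod by simp
      qed
      show False
      proof (rule finish)
        show "35 * m \<ge> 16" "m \<noteq> 1" "m \<noteq> 20" using m m_eq by auto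
        then show "(35 * m - 16) mod 8 \<in> {1, 2, 3, 5, 6} \<or> (\<exists>k. 35 * m - 16 = 4 * k \<and> k mod 8 \<in> {2, 6})"
          using shift[of 2] by auto
        show "(35 * m - 1296) mod 8 \<in> {1, 2, 3, 5, 6} \<or> (\<exists>k. 35 * m - 1296 = 4 * k \<and> k mod 8 \<in> {2, 6})"
          if "35 * m \<ge> 1296"
          using shift[of 162] that by auto
      qed
    next
      assume m: "m mod 16 = 8"
      define j where "j = m div 16"
      have "m = 16 * j + m mod 16" by (simp add: j_def)
      then have m_eq: "m = 16 * j + 8" using m by simp
      show False
      proof (rule finish)
        show "35 * m \<ge> 16" using m_eq by simp
        show "m \<noteq> 1" "m \<noteq> 20" using m by auto
        have "35 * m - 16 = 4 * (140 * j + 66)" using m_eq by simp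
        moreover have "(140 * j + 66) mod 8 \<in> {2, 6}" by (simp, presburger)
        ultimately show "(35 * m - 16) mod 8 \<in> {1, 2, 3, 5, 6} \<or> (\<exists>k. 35 * m - 16 = 4 * k \<and> k mod 8 \<in> {2, 6})"
          by blast
        assume "35 * m \<ge> 1296"
        then have "j \<ge> 2" using m_eq by simp
        then obtain i where "j = i + 2" by (metis add.commute le_Suc_ex)
        then have "35 * m - 1296 = 4 * (140 * i + 26)" using m_eq by simp
        moreover have "(140 * i + 26) mod 8 \<in> {2, 6}" by (simp, presburger)
        ultimately show "(35 * m - 1296) mod 8 \<in> {1, 2, 3, 5, 6} \<or> (\<exists>k. 35 * m - 1296 = 4 * k \<and> k mod 8 \<in> {2, 6})"
          by blast
      qed
    }
  qed
qed

theorem theorem15: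
  shows "(\<forall>m::nat. \<exists>x y z t :: int.
            int m = x^2 + y^2 + z^2 + t^2 \<and>
            (\<exists>n::nat. x + 3*y + 5*z = (int n)^2)) \<and>
         (\<forall>m::nat. \<not> 16 dvd m \<longrightarrow>
            (\<exists>x y z t :: int.
               int m = x^2 + y^2 + z^2 + t^2 \<and>
               x + 3*y + 5*z \<in> {1, 4, 9, 36}))"
proof (intro conjI allI impI)
  show small: "\<exists>x y z t :: int. int m = x^2 + y^2 + z^2 + t^2 \<and> x + 3*y + 5*z \<in> {1, 4, 9, 36}"
    if "\<not> 16 dvd m" for m :: nat
    using rep_135_small_squares[OF that] unfolding rep_135_def by blast
  show "\<exists>x y z t :: int. int m = x^2 + y^2 + z^2 + t^2 \<and> (\<exists>n::nat. x + 3*y + 5*z = (int n)^2)" for m :: nat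
  proof (induction m rule: less_induct)
    case (less m)
    show ?case
    proof (cases "16 dvd m")
      case False
      have squares: "\<exists>n::nat. a = (int n)^2" if "a \<in> {1, 4, 9, 36}" for a
      proof -
        have "a = (int 1)^2 \<or> a = (int 2)^2 \<or> a = (int 3)^2 \<or> a = (int 6)^2" using that by auto
        then show ?thesis by blast
      qed
      then show ?thesis using small[OF False] by blast
    next
      case True
      \<comment> \<open>Scaling a solution for k by 4 multiplies the norm by 16 and the linear form
        by 4, which is itself a square.\<close>
      then obtain k where k: "m = 16 * k" by blast
      show ?thesis
      proof (cases "m = 0")
        case True
        then show ?thesis by (intro exI[of _ 0]) simp
      next
        case False
        then have "k < m" using k by simp
        then obtain x y z t :: int and n :: nat where
          "int k = x^2 + y^2 + z^2 + t^2" "x + 3*y + 5*z = (int n)^2" using less.IH by blast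
        then have "int m = (4*x)^2 + (4*y)^2 + (4*z)^2 + (4*t)^2" "4*x + 3*(4*y) + 5*(4*z) = (int (2*n))^2"
          using k by (simp_all add: power_mult_distrib algebra_simps)
        then show ?thesis by blast
      qed
    qed
  qed
qed

end
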